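(* Let $X$ and $\Lambda$ be finite sets; for each $\lambda\in\Lambda$ let $G_\lambda$ be a finite group and $\rho_\lambda\colon X\to G_\lambda^\sharp$ a map. Let $\mathcal Z$ be a set of subsets of $\Lambda$. Let $\Delta(X,\rho,\mathcal Z)\ge0$ be the least real number such that \[\sum_{D\in\mathcal Z}\sum_{\chi\in\operatorname{Prim}(G_D)}\Big|\sum_{v\in X}a_v\chi(\rho_D(v))\Big|^2\le\Delta(X,\rho,\mathcal Z)\sum_{v\in X}|a_v|^2\] for every sequence $(a_v)_{v\in X}$ of complex numbers. Let $\mathscr S\subseteq X$, and for each $\lambda\in\Lambda$ fix a real number $0<\delta_\lambda\le1$ with $\mu_\lambda(\rho_\lambda(\mathscr S))\le\delta_\lambda$. Define \[L(\mathcal Z)=\sum_{D\in\mathcal Z}\prod_{\lambda\in D}\frac{1-\delta_\lambda}{\delta_\lambda}.\] Then $L(\mathcal Z)\,|\mathscr S|\le\Delta(X,\rho,\mathcal Z)$.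
   Context: For a finite group $G$, $G^\sharp$ denotes its set of conjugacy classes and $\operatorname{Irr}(G)$ the set of characters of irreducible complex representations of $G$. $\mu_\lambda$ is the probability measure on $G_\lambda^\sharp$ given by $\mu_\lambda(U)=|G_\lambda|^{-1}\sum_{C\in U}|C|$ for $U\subseteq G_\lambda^\sharp$. For $D\subseteq\Lambda$, $G_D=\prod_{\lambda\in D}G_\lambda$ (with $G_\emptyset$ trivial), and $\rho_D\colon X\to G_D^\sharp$ sends $v$ to the conjugacy class $\prod_{\lambda\in D}\rho_\lambda(v)$. For $E\subseteq D$, composition with the projection $G_D\to G_E$ gives an injection $\operatorname{Irr}(G_E)\hookrightarrow\operatorname{Irr}(G_D)$; a character $\chi\in\operatorname{Irr}(G_D)$ is imprimitive if it comes from $\operatorname{Irr}(G_E)$ for some proper subset $E\subsetneq D$, and primitive otherwise. $\operatorname{Prim}(G_D)$ is the set of primitive characters in $\operatorname{Irr}(G_D)$ (so $\operatorname{Prim}(G_\emptyset)=\{1\}$). Characters are evaluated on conjugacy classes in the obvious way. *)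

theory Defs
  imports "HOL-Algebra.Product_Groups" "Jordan_Normal_Form.Matrix" Complex_Main
begin

definition conj_class :: "('a, 'b) monoid_scheme \<Rightarrow> 'a \<Rightarrow> 'a set" where
  "conj_class G x = {inv\<^bsub>G\<^esub> g \<otimes>\<^bsub>G\<^esub> x \<otimes>\<^bsub>G\<^esub> g | g. g \<in> carrier G}"

definition conj_classes :: "('a, 'b) monoid_scheme \<Rightarrow> 'a set set" where
  "conj_classes G = conj_class G ` carrier G"

definition class_measure :: "('a, 'b) monoid_scheme \<Rightarrow> 'a set set \<Rightarrow> real" where
  "class_measure G U = (\<Sum>C\<in>U. real (card C)) / real (card (carrier G))"

definition mat_trace :: "complex mat \<Rightarrow> complex" where
  "mat_trace A = (\<Sum>i<dim_row A. A $$ (i, i))"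

definition is_rep :: "('a, 'b) monoid_scheme \<Rightarrow> nat \<Rightarrow> ('a \<Rightarrow> complex mat) \<Rightarrow> bool" where
  "is_rep G n R \<longleftrightarrow>
     (\<forall>g\<in>carrier G. R g \<in> carrier_mat n n) \<and>
     R \<one>\<^bsub>G\<^esub> = 1\<^sub>m n \<and>
     (\<forall>g\<in>carrier G. \<forall>h\<in>carrier G. R (g \<otimes>\<^bsub>G\<^esub> h) = R g * R h)"

definition invariant_subspace :: "('a, 'b) monoid_scheme \<Rightarrow> nat \<Rightarrow> ('a \<Rightarrow> complex mat) \<Rightarrow> complex vec set \<Rightarrow> bool" where
  "invariant_subspace G n R W \<longleftrightarrow>
     W \<subseteq> carrier_vec n \<and> 0\<^sub>v n \<in> W \<and>
     (\<forall>v\<in>W. \<forall>w\<in>W. v + w \<in> W) \<and>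
     (\<forall>c. \<forall>w\<in>W. c \<cdot>\<^sub>v w \<in> W) \<and>
     (\<forall>g\<in>carrier G. \<forall>w\<in>W. R g *\<^sub>v w \<in> W)"

definition irreducible_rep :: "('a, 'b) monoid_scheme \<Rightarrow> nat \<Rightarrow> ('a \<Rightarrow> complex mat) \<Rightarrow> bool" where
  "irreducible_rep G n R \<longleftrightarrow> is_rep G n R \<and> n > 0 \<and>
     (\<forall>W. invariant_subspace G n R W \<longrightarrow> W = {0\<^sub>v n} \<or> W = carrier_vec n)"

definition Irr :: "('a, 'b) monoid_scheme \<Rightarrow> ('a \<Rightarrow> complex) set" where
  "Irr G = {\<lambda>g\<in>carrier G. mat_trace (R g) | n R. irreducible_rep G n R}"

definition G_prod :: "('l \<Rightarrow> ('g, 'b) monoid_scheme) \<Rightarrow> 'l set \<Rightarrow> ('l \<Rightarrow> 'g) monoid" where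
  "G_prod G D = product_group D G"

definition inflate :: "('l \<Rightarrow> ('g, 'b) monoid_scheme) \<Rightarrow> 'l set \<Rightarrow> 'l set \<Rightarrow> (('l \<Rightarrow> 'g) \<Rightarrow> complex) \<Rightarrow> (('l \<Rightarrow> 'g) \<Rightarrow> complex)" where
  "inflate G D E \<psi> = (\<lambda>f\<in>carrier (G_prod G D). \<psi> (restrict f E))"

definition Prim :: "('l \<Rightarrow> ('g, 'b) monoid_scheme) \<Rightarrow> 'l set \<Rightarrow> (('l \<Rightarrow> 'g) \<Rightarrow> complex) set" where
  "Prim G D = {\<chi> \<in> Irr (G_prod G D).
      \<not> (\<exists>E. E \<subset> D \<and> (\<exists>\<psi>\<in>Irr (G_prod G E). \<chi> = inflate G D E \<psi>))}"

definition rho_D :: "('l \<Rightarrow> 'x \<Rightarrow> 'g set) \<Rightarrow> 'l set \<Rightarrow> 'x \<Rightarrow> ('l \<Rightarrow> 'g) set" where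
  "rho_D \<rho> D v = (\<Pi>\<^sub>E l\<in>D. \<rho> l v)"

(* evaluation of a class function on a conjugacy class *)
definition eval_class :: "('a \<Rightarrow> complex) \<Rightarrow> 'a set \<Rightarrow> complex" where
  "eval_class \<chi> C = \<chi> (SOME x. x \<in> C)"

definition large_sieve_const :: "('l \<Rightarrow> ('g, 'b) monoid_scheme) \<Rightarrow> 'x set \<Rightarrow> ('l \<Rightarrow> 'x \<Rightarrow> 'g set) \<Rightarrow> 'l set set \<Rightarrow> real" where
  "large_sieve_const G X \<rho> Z = Inf {c. c \<ge> 0 \<and> (\<forall>a :: 'x \<Rightarrow> complex.
      (\<Sum>D\<in>Z. \<Sum>\<chi>\<in>Prim G D. (cmod (\<Sum>v\<in>X. a v * eval_class \<chi> (rho_D \<rho> D v)))\<^sup>2)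
        \<le> c * (\<Sum>v\<in>X. (cmod (a v))\<^sup>2))}"

end

theory Submission
  imports Defs "Jordan_Normal_Form.Spectral_Radius"
begin

text \<open>
  Testing the large sieve inequality on the indicator function of \<open>S\<close>, it suffices to bound
  $\sum_{\chi \in \mathrm{Prim}(G_D)} |\sum_{v \in S} \chi(\rho_D(v))|^2$ from below by
  $|S|^2 \prod_{\lambda \in D} (1 - \delta_\lambda)/\delta_\lambda$. Expanding the square, this is the quadratic form
  of the kernel $\sum_{\chi \in \mathrm{Prim}(G_D)} \chi(\rho_D(v)) \overline{\chi(\rho_D(w))}$.
  Summed over all of $\mathrm{Irr}(G_D)$ the kernel equals $\prod_{\lambda \in D} k_\lambda(v, w)$ by column orthogonality, where
  $k_\lambda(v, w) = |G_\lambda| / |\rho_\lambda(v)|$ if $\rho_\lambda(v) = \rho_\lambda(w)$ and $0$ otherwise. Since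
  every irreducible character of $G_D$ is inflated from a unique primitive one, inclusion-exclusion
  shows that the primitive kernel is $\prod_{\lambda \in D} (k_\lambda - 1)$, and it is not necessary to know that
  the irreducible characters of a product are products. Finally $k_\lambda - 1/\delta_\lambda$ is positive semidefinite on \<open>S\<close>,
  and Schur products of positive semidefinite kernels are positive semidefinite.
\<close>

section \<open>Complex matrices\<close>

text \<open>The constant comes from Cauchy-Schwarz on a single factor. There the kernel is
  1/\<mu>(C) on pairs lying in a common class C, and for a vector on S with class sums y_C the sum
  of |y_C|^2/\<mu>(C) is at least |sum y_C|^2/\<mu>(\<rho>(S)), hence at least |sum y_C|^2/\<delta>.
  So k - 1 dominates the constant kernel 1/\<delta> - 1 = (1 - \<delta>)/\<delta>. This constant is
  nonnegative because \<delta> \<le> 1, which is what lets the domination pass to products over D.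
  The indicator of S has squared norm |S|, so one of the two factors |S| cancels.

  The kernel over Irr has to be known exactly, since inclusion-exclusion has alternating signs and
  an inequality would not survive it. Column orthogonality therefore rests on both halves of
  character theory: orthonormality of characters and their completeness among class functions. The
  other delicate point is that a character inflated from two subsets of D is inflated from their
  intersection; otherwise its primitive origin would not be well defined.\<close>

text \<open>The dimensions are arguments because matrices of all sizes share one type, so a sum over
  an empty index set has to be told its shape.\<close>

definition mat_sum :: "nat \<Rightarrow> nat \<Rightarrow> 'i set \<Rightarrow> ('i \<Rightarrow> complex mat) \<Rightarrow> complex mat" where
  "mat_sum n m I F = mat n m (\<lambda>(i, j). \<Sum>s\<in>I. F s $$ (i, j))"

lemma mat_sum_carrier [simp]: "mat_sum n m I F \<in> carrier_mat n m"
  and dim_row_mat_sum [simp]: "dim_row (mat_sum n m I F) = n"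
  and dim_col_mat_sum [simp]: "dim_col (mat_sum n m I F) = m"
  and index_mat_sum [simp]: "i < n \<Longrightarrow> j < m \<Longrightarrow> mat_sum n m I F $$ (i, j) = (\<Sum>s\<in>I. F s $$ (i, j))"
  by (auto simp: mat_sum_def)

lemma mat_sum_cong:
  "I = J \<Longrightarrow> (\<And>s. s \<in> J \<Longrightarrow> F s = F' s) \<Longrightarrow> mat_sum n m I F = mat_sum n m J F'"
  by (auto simp: mat_sum_def)

lemma mat_sum_reindex_bij_betw:
  "bij_betw p I J \<Longrightarrow> mat_sum n m I (\<lambda>s. F (p s)) = mat_sum n m J F"
  unfolding mat_sum_def by (rule cong_mat) (auto intro: sum.reindex_bij_betw)

lemma index_mult_mat_sum:
  assumes "A \<in> carrier_mat n k" "B \<in> carrier_mat k m" "i < n" "j < m"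
  shows "(A * B) $$ (i, j) = (\<Sum>l<k. A $$ (i, l) * B $$ (l, j))"
  using assms by (auto simp: scalar_prod_def atLeast0LessThan)

lemma index_mult_mat_vec_sum:
  assumes "A \<in> carrier_mat n k" "v \<in> carrier_vec k" "i < n"
  shows "(A *\<^sub>v v) $ i = (\<Sum>l<k. A $$ (i, l) * v $ l)"
  using assms by (auto simp: scalar_prod_def atLeast0LessThan)

lemma mult_mat_sum:
  assumes A: "A \<in> carrier_mat p n" and F: "\<And>s. s \<in> I \<Longrightarrow> F s \<in> carrier_mat n m"
  shows "A * mat_sum n m I F = mat_sum p m I (\<lambda>s. A * F s)"
proof (rule eq_matI)
  fix i j assume "i < dim_row (mat_sum p m I (\<lambda>s. A * F s))" "j < dim_col (mat_sum p m I (\<lambda>s. A * F s))"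
  then have ij: "i < p" "j < m" by auto
  have "(A * mat_sum n m I F) $$ (i, j) = (\<Sum>l<n. A $$ (i, l) * (\<Sum>s\<in>I. F s $$ (l, j)))"
    using ij by (subst index_mult_mat_sum[OF A mat_sum_carrier]) auto
  also have "\<dots> = (\<Sum>s\<in>I. \<Sum>l<n. A $$ (i, l) * F s $$ (l, j))"
    unfolding sum_distrib_left by (rule sum.swap)
  also have "\<dots> = (\<Sum>s\<in>I. (A * F s) $$ (i, j))"
    by (rule sum.cong[OF refl]) (rule index_mult_mat_sum[OF A F ij, symmetric])
  finally show "(A * mat_sum n m I F) $$ (i, j) = mat_sum p m I (\<lambda>s. A * F s) $$ (i, j)"
    using ij by simp
qed (use A in auto)

lemma mat_sum_mult:
  assumes A: "A \<in> carrier_mat m p" and F: "\<And>s. s \<in> I \<Longrightarrow> F s \<in> carrier_mat n m"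
  shows "mat_sum n m I F * A = mat_sum n p I (\<lambda>s. F s * A)"
proof (rule eq_matI)
  fix i j assume "i < dim_row (mat_sum n p I (\<lambda>s. F s * A))" "j < dim_col (mat_sum n p I (\<lambda>s. F s * A))"
  then have ij: "i < n" "j < p" by auto
  have "(mat_sum n m I F * A) $$ (i, j) = (\<Sum>l<m. (\<Sum>s\<in>I. F s $$ (i, l)) * A $$ (l, j))"
    using ij by (subst index_mult_mat_sum[OF mat_sum_carrier A]) auto
  also have "\<dots> = (\<Sum>s\<in>I. \<Sum>l<m. F s $$ (i, l) * A $$ (l, j))"
    unfolding sum_distrib_right by (rule sum.swap)
  also have "\<dots> = (\<Sum>s\<in>I. (F s * A) $$ (i, j))"
    by (rule sum.cong[OF refl]) (rule index_mult_mat_sum[OF F A ij, symmetric])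
  finally show "(mat_sum n m I F * A) $$ (i, j) = mat_sum n p I (\<lambda>s. F s * A) $$ (i, j)"
    using ij by simp
qed (use A in auto)

lemma mat_trace_comm:
  assumes A: "A \<in> carrier_mat n m" and B: "B \<in> carrier_mat m n"
  shows "mat_trace (A * B) = mat_trace (B * A)"
proof -
  have "mat_trace (A * B) = (\<Sum>i<n. \<Sum>l<m. A $$ (i, l) * B $$ (l, i))"
    unfolding mat_trace_def using A by (auto intro!: sum.cong index_mult_mat_sum[OF A B])
  also have "\<dots> = (\<Sum>l<m. \<Sum>i<n. B $$ (l, i) * A $$ (i, l))"
    by (subst sum.swap) (simp add: mult.commute)
  also have "\<dots> = mat_trace (B * A)"
    unfolding mat_trace_def using B by (auto intro!: sum.cong index_mult_mat_sum[OF B A, symmetric])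
  finally show ?thesis .
qed

lemma mat_trace_mat_sum:
  assumes "\<And>s. s \<in> I \<Longrightarrow> F s \<in> carrier_mat n n"
  shows "mat_trace (mat_sum n n I F) = (\<Sum>s\<in>I. mat_trace (F s))"
proof -
  have "mat_trace (mat_sum n n I F) = (\<Sum>i<n. \<Sum>s\<in>I. F s $$ (i, i))"
    by (simp add: mat_trace_def)
  also have "\<dots> = (\<Sum>s\<in>I. \<Sum>i<n. F s $$ (i, i))" by (rule sum.swap)
  also have "\<dots> = (\<Sum>s\<in>I. mat_trace (F s))"
    unfolding mat_trace_def using assms by (intro sum.cong) auto
  finally show ?thesis .
qed

lemma mat_trace_eq_sum: "A \<in> carrier_mat n n \<Longrightarrow> mat_trace A = (\<Sum>i<n. A $$ (i, i))"
  by (auto simp: mat_trace_def)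

definition unit_mat :: "nat \<Rightarrow> nat \<Rightarrow> nat \<Rightarrow> nat \<Rightarrow> complex mat" where
  "unit_mat n m a b = mat n m (\<lambda>(i, j). if i = a \<and> j = b then 1 else 0)"

lemma unit_mat_carrier [simp]: "unit_mat n m a b \<in> carrier_mat n m"
  by (simp add: unit_mat_def)

text \<open>Since the entry factors, averaging \<open>R g * unit_mat n m a b * T (inv g)\<close>
  over a group yields sums of products of matrix coefficients. This is the bridge from Schur's lemma
  to orthogonality of characters.\<close>

lemma index_mult_unit_mat_mult:
  assumes P: "P \<in> carrier_mat n n" and Q: "Q \<in> carrier_mat m m" and "i < n" "a < n" "b < m" "j < m"
  shows "(P * unit_mat n m a b * Q) $$ (i, j) = P $$ (i, a) * Q $$ (b, j)"
proof -
  have PE: "(P * unit_mat n m a b) $$ (i, l) = (if l = b then P $$ (i, a) else 0)" if "l < m" for l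
  proof -
    have "(P * unit_mat n m a b) $$ (i, l) = (\<Sum>k<n. P $$ (i, k) * unit_mat n m a b $$ (k, l))"
      by (rule index_mult_mat_sum[OF P]) (use assms that in auto)
    also have "\<dots> = (\<Sum>k<n. if k = a then (if l = b then P $$ (i, a) else 0) else 0)"
      using that by (intro sum.cong) (auto simp: unit_mat_def)
    finally show ?thesis using assms by simp
  qed
  have "(P * unit_mat n m a b * Q) $$ (i, j) = (\<Sum>l<m. (P * unit_mat n m a b) $$ (i, l) * Q $$ (l, j))"
    by (rule index_mult_mat_sum[OF _ Q]) (use assms in auto)
  also have "\<dots> = (\<Sum>l<m. if l = b then P $$ (i, a) * Q $$ (b, j) else 0)"
    by (intro sum.cong) (auto simp: PE)
  finally show ?thesis using assms by simp
qed

definition adjoint_mat :: "complex mat \<Rightarrow> complex mat" where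
  "adjoint_mat A = mat (dim_col A) (dim_row A) (\<lambda>(i, j). cnj (A $$ (j, i)))"

lemma adjoint_mat_carrier [simp]: "A \<in> carrier_mat n m \<Longrightarrow> adjoint_mat A \<in> carrier_mat m n"
  by (auto simp: adjoint_mat_def)

lemma index_adjoint_mat [simp]:
  "i < dim_col A \<Longrightarrow> j < dim_row A \<Longrightarrow> adjoint_mat A $$ (i, j) = cnj (A $$ (j, i))"
  by (simp add: adjoint_mat_def)

lemma adjoint_mat_mult:
  assumes A: "A \<in> carrier_mat n k" and B: "B \<in> carrier_mat k m"
  shows "adjoint_mat (A * B) = adjoint_mat B * adjoint_mat A"
proof (rule eq_matI)
  fix i j assume "i < dim_row (adjoint_mat B * adjoint_mat A)" "j < dim_col (adjoint_mat B * adjoint_mat A)"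
  then have ij: "i < m" "j < n" using A B by (auto simp: adjoint_mat_def)
  have "adjoint_mat (A * B) $$ (i, j) = cnj (\<Sum>l<k. A $$ (j, l) * B $$ (l, i))"
    using ij A B by (simp add: index_mult_mat_sum[OF A B ij(2,1), symmetric] del: cnj_sum index_mult_mat(1))
  also have "\<dots> = (\<Sum>l<k. adjoint_mat B $$ (i, l) * adjoint_mat A $$ (l, j))"
    using ij A B by (auto simp: mult.commute)
  also have "\<dots> = (adjoint_mat B * adjoint_mat A) $$ (i, j)"
    by (rule index_mult_mat_sum[symmetric, OF _ _ ij]) (use A B in auto)
  finally show "adjoint_mat (A * B) $$ (i, j) = (adjoint_mat B * adjoint_mat A) $$ (i, j)" .
qed (use A B in \<open>auto simp: adjoint_mat_def\<close>)

lemma adjoint_mat_one [simp]: "adjoint_mat (1\<^sub>m n) = 1\<^sub>m n"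
  by (auto simp: adjoint_mat_def)

lemma mat_trace_adjoint: "A \<in> carrier_mat n n \<Longrightarrow> mat_trace (adjoint_mat A) = cnj (mat_trace A)"
  by (auto simp: mat_trace_def adjoint_mat_def)

lemma mat_trace_one [simp]: "mat_trace (1\<^sub>m n) = of_nat n"
  by (simp add: mat_trace_def)

lemma mat_trace_smult: "mat_trace (c \<cdot>\<^sub>m A) = c * mat_trace A" if "A \<in> carrier_mat n n"
  using that by (auto simp: mat_trace_def sum_distrib_left)

lemma mat_vec_ext:
  fixes A B :: "complex mat"
  assumes A: "A \<in> carrier_mat n m" and B: "B \<in> carrier_mat n m"
    and eq: "\<And>v. v \<in> carrier_vec m \<Longrightarrow> A *\<^sub>v v = B *\<^sub>v v"
  shows "A = B"
proof (rule eq_matI)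
  fix i j assume ij: "i < dim_row B" "j < dim_col B"
  have "A *\<^sub>v unit_vec m j = B *\<^sub>v unit_vec m j" by (rule eq) auto
  then have "(A *\<^sub>v unit_vec m j) $ i = (B *\<^sub>v unit_vec m j) $ i" by simp
  then show "A $$ (i, j) = B $$ (i, j)" using ij A B by auto
qed (use A B in auto)

lemma mult_mat_zero_vec: "A \<in> carrier_mat n m \<Longrightarrow> A *\<^sub>v 0\<^sub>v m = 0\<^sub>v n"
  and zero_mat_mult_vec: "v \<in> carrier_vec m \<Longrightarrow> 0\<^sub>m n m *\<^sub>v v = 0\<^sub>v n"
  for A :: "complex mat"
  by (auto intro!: eq_vecI simp: scalar_prod_def)

lemma minus_vec_eq_zeroD:
  fixes v w :: "complex vec"
  assumes "v \<in> carrier_vec n" "w \<in> carrier_vec n" "v - w = 0\<^sub>v n"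
  shows "v = w"
proof (rule eq_vecI)
  fix i assume "i < dim_vec w"
  then have i: "i < n" and "(v - w) $ i = 0" using assms by (simp_all only: carrier_vecD index_zero_vec)
  then show "v $ i = w $ i" using assms(1,2) by simp
qed (use assms in auto)

text \<open>Column \<open>j\<close> of \<open>C\<close> is a chosen preimage under \<open>B\<close>
  of column \<open>j\<close> of \<open>M\<close>. This yields right inverses of surjective matrices,
  and the matrix of a linear map restricted to the column space of \<open>B\<close>.\<close>

lemma mat_factor_left:
  fixes B M :: "complex mat"
  assumes B: "B \<in> carrier_mat n m" and M: "M \<in> carrier_mat n p"
    and ex: "\<And>v. v \<in> carrier_vec p \<Longrightarrow> \<exists>x\<in>carrier_vec m. B *\<^sub>v x = M *\<^sub>v v"
  shows "\<exists>C\<in>carrier_mat m p. B * C = M"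
proof -
  have "\<forall>j. \<exists>v\<in>carrier_vec m. B *\<^sub>v v = M *\<^sub>v unit_vec p j" using ex by auto
  then obtain c where c: "\<And>j. c j \<in> carrier_vec m" "\<And>j. B *\<^sub>v c j = M *\<^sub>v unit_vec p j" by metis
  define C where "C = mat m p (\<lambda>(i, j). c j $ i)"
  have C: "C \<in> carrier_mat m p" by (simp add: C_def)
  have "B * C = M"
  proof (rule eq_matI)
    fix i j assume "i < dim_row M" "j < dim_col M"
    then have ij: "i < n" "j < p" using M by auto
    have "col C j = c j" using ij c(1)[of j] by (intro eq_vecI) (auto simp: C_def)
    then have "(B * C) $$ (i, j) = (B *\<^sub>v c j) $ i" using B C ij by simp
    also have "\<dots> = M $$ (i, j)" unfolding c(2) using M ij by simp
    finally show "(B * C) $$ (i, j) = M $$ (i, j)" .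
  qed (use B C M in auto)
  with C show ?thesis by blast
qed

lemma smult_mat_mult_vec:
  fixes A :: "complex mat"
  assumes "A \<in> carrier_mat n m" "v \<in> carrier_vec m"
  shows "(c \<cdot>\<^sub>m A) *\<^sub>v v = c \<cdot>\<^sub>v (A *\<^sub>v v)"
  using assms by (auto intro!: eq_vecI simp: scalar_prod_def sum_distrib_left mult.assoc)

text \<open>\<open>P\<close> equals \<open>A * Q * C\<close>, and the trace is cyclic.
  \<open>A\<close> may be rectangular a priori, so equality of \<open>n\<close> and \<open>m\<close>
  never has to be derived.\<close>

lemma mat_trace_eq_of_intertwiner:
  assumes A: "A \<in> carrier_mat n m" and C: "C \<in> carrier_mat m n" "A * C = 1\<^sub>m n" "C * A = 1\<^sub>m m"
    and R: "P \<in> carrier_mat n n" and T: "Q \<in> carrier_mat m m" and eq: "P * A = A * Q"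
  shows "mat_trace P = mat_trace Q"
proof -
  have "P = P * (A * C)" unfolding C(2) using R by simp
  also have "\<dots> = (P * A) * C" using A C(1) R by simp
  also have "\<dots> = A * (Q * C)" unfolding eq using A C(1) T by simp
  finally have "mat_trace P = mat_trace ((Q * C) * A)"
    using mat_trace_comm[OF A, of "Q * C"] C(1) T by simp
  also have "(Q * C) * A = Q * (C * A)" using A C(1) T by simp
  also have "\<dots> = Q" unfolding C(3) using T by simp
  finally show ?thesis .
qed

section \<open>Subspaces as column spaces of injective matrices\<close>

text \<open>Independence of the columns: a subspace of dimension \<open>k\<close> is handled as the
  column space of such a matrix with \<open>k\<close> columns, which turns restriction to subspaces
  into matrix products.\<close>

definition mat_inj :: "nat \<Rightarrow> complex mat \<Rightarrow> bool" where
  "mat_inj k B \<longleftrightarrow> (\<forall>x\<in>carrier_vec k. B *\<^sub>v x = 0\<^sub>v (dim_row B) \<longrightarrow> x = 0\<^sub>v k)"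

lemma mat_injD: "mat_inj k B \<Longrightarrow> B \<in> carrier_mat n k \<Longrightarrow> x \<in> carrier_vec k \<Longrightarrow> B *\<^sub>v x = 0\<^sub>v n \<Longrightarrow> x = 0\<^sub>v k"
  by (auto simp: mat_inj_def)

lemma mat_inj_mult:
  assumes B: "mat_inj k B" "B \<in> carrier_mat n k" and C: "mat_inj j C" "C \<in> carrier_mat k j"
  shows "mat_inj j (B * C)"
  unfolding mat_inj_def
proof (intro ballI impI)
  fix x :: "complex vec" assume x: "x \<in> carrier_vec j" and 0: "B * C *\<^sub>v x = 0\<^sub>v (dim_row (B * C))"
  then have "B *\<^sub>v (C *\<^sub>v x) = 0\<^sub>v n" using B(2) C(2) by simp
  then have "C *\<^sub>v x = 0\<^sub>v k" by (rule mat_injD[OF B, rotated]) (use C x in auto)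
  then show "x = 0\<^sub>v j" by (rule mat_injD[OF C x])
qed

lemma mat_inj_cancel:
  assumes B: "mat_inj k B" "B \<in> carrier_mat n k" and C: "C \<in> carrier_mat k j" "C' \<in> carrier_mat k j"
    and eq: "B * C = B * C'"
  shows "C = C'"
proof (rule mat_vec_ext[OF C])
  fix v :: "complex vec" assume v: "v \<in> carrier_vec j"
  have "B *\<^sub>v (C *\<^sub>v v) = B *\<^sub>v (C' *\<^sub>v v)"
    using B C v eq by (metis assoc_mult_mat_vec)
  then have "B *\<^sub>v (C *\<^sub>v v - C' *\<^sub>v v) = 0\<^sub>v n"
    using B C v by (subst mult_minus_distrib_mat_vec[of _ n k]) auto
  then have "C *\<^sub>v v - C' *\<^sub>v v = 0\<^sub>v k" by (rule mat_injD[OF B, rotated]) (use C v in auto)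
  then show "C *\<^sub>v v = C' *\<^sub>v v" by (rule minus_vec_eq_zeroD[rotated 2]) (use C v in auto)
qed

text \<open>If \<open>n < k\<close>, padding \<open>B\<close> with zero rows gives a singular square
  matrix, and a vector in its kernel is also killed by \<open>B\<close>.\<close>

lemma mat_inj_le:
  assumes B: "mat_inj k B" "B \<in> carrier_mat n k"
  shows "k \<le> n"
proof (rule ccontr)
  assume "\<not> k \<le> n"
  then have kn: "n < k" by simp
  define C where "C = mat k k (\<lambda>(i, j). if i < n then B $$ (i, j) else 0)"
  have C: "C \<in> carrier_mat k k" by (simp add: C_def)
  \<comment> \<open>Row \<open>n\<close> of \<open>C\<close> is zero, so the transpose kills a
    nonzero vector and the determinant vanishes.\<close>
  have "transpose_mat C *\<^sub>v unit_vec k n = 0\<^sub>v k"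
    using kn by (intro eq_vecI) (auto simp: C_def)
  moreover have "unit_vec k n \<noteq> (0\<^sub>v k :: complex vec)" using kn by simp
  ultimately have "det (transpose_mat C) = 0"
    using C by (subst det_0_iff_vec_prod_zero_field[of _ k]) (auto intro!: exI[of _ "unit_vec k n"])
  then have "det C = 0" using det_transpose[OF C] by simp
  then obtain x where x: "x \<in> carrier_vec k" "x \<noteq> 0\<^sub>v k" "C *\<^sub>v x = 0\<^sub>v k"
    using det_0_iff_vec_prod_zero_field[OF C] by auto
  have "B *\<^sub>v x = 0\<^sub>v n"
  proof (rule eq_vecI)
    fix i assume "i < dim_vec (0\<^sub>v n :: complex vec)"
    then have i: "i < n" by simp
    have "(B *\<^sub>v x) $ i = (\<Sum>l<k. B $$ (i, l) * x $ l)" by (rule index_mult_mat_vec_sum[OF B(2) x(1) i])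
    also have "\<dots> = (\<Sum>l<k. C $$ (i, l) * x $ l)" using i kn by (intro sum.cong) (auto simp: C_def)
    also have "\<dots> = (C *\<^sub>v x) $ i" by (rule index_mult_mat_vec_sum[OF C x(1), symmetric]) (use i kn in auto)
    finally show "(B *\<^sub>v x) $ i = 0\<^sub>v n $ i" using i kn by (simp add: x(3))
  qed (use B in auto)
  then show False using mat_injD[OF B x(1)] x(2) by simp
qed

text \<open>\<open>w\<close> is adjoined as a last column; a relation with nonzero last coefficient
  would express \<open>w\<close> through \<open>B\<close>. The second conjunct describes the new
  column space, so that it can be confined to a given subspace.\<close>

lemma mat_inj_extend:
  assumes B: "mat_inj k B" "B \<in> carrier_mat n k" and w: "w \<in> carrier_vec n"
    and notin: "\<And>x. x \<in> carrier_vec k \<Longrightarrow> B *\<^sub>v x \<noteq> w"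
  shows "\<exists>B'\<in>carrier_mat n (Suc k). mat_inj (Suc k) B' \<and>
    (\<forall>x\<in>carrier_vec (Suc k). \<exists>y\<in>carrier_vec k. \<exists>c. B' *\<^sub>v x = B *\<^sub>v y + c \<cdot>\<^sub>v w)"
proof -
  define B' where "B' = mat n (Suc k) (\<lambda>(i, j). if j < k then B $$ (i, j) else w $ i)"
  have B': "B' \<in> carrier_mat n (Suc k)" by (simp add: B'_def)
  define r where "r x = vec k (\<lambda>i. x $ i)" for x :: "complex vec"
  have r [simp]: "r x \<in> carrier_vec k" for x by (simp add: r_def)
  have split: "B' *\<^sub>v x = B *\<^sub>v r x + x $ k \<cdot>\<^sub>v w" if x: "x \<in> carrier_vec (Suc k)" for x
  proof (rule eq_vecI)
    fix i assume "i < dim_vec (B *\<^sub>v r x + x $ k \<cdot>\<^sub>v w)"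
    then have i: "i < n" using w by simp
    have "(B' *\<^sub>v x) $ i = (\<Sum>l<Suc k. B' $$ (i, l) * x $ l)" by (rule index_mult_mat_vec_sum[OF B' x i])
    also have "\<dots> = (\<Sum>l<k. B $$ (i, l) * r x $ l) + w $ i * x $ k"
      using i by (simp add: B'_def r_def)
    also have "(\<Sum>l<k. B $$ (i, l) * r x $ l) = (B *\<^sub>v r x) $ i"
      by (rule index_mult_mat_vec_sum[OF B(2) r i, symmetric])
    finally show "(B' *\<^sub>v x) $ i = (B *\<^sub>v r x + x $ k \<cdot>\<^sub>v w) $ i"
      using i w by (simp add: mult.commute del: index_mult_mat_vec)
  qed (use B B' w in auto)
  have "mat_inj (Suc k) B'"
    unfolding mat_inj_def
  proof (intro ballI impI)
    fix x :: "complex vec" assume x: "x \<in> carrier_vec (Suc k)" and "B' *\<^sub>v x = 0\<^sub>v (dim_row B')"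
    then have 0: "B *\<^sub>v r x + x $ k \<cdot>\<^sub>v w = 0\<^sub>v n" using B' split[OF x] by simp
    have xk: "x $ k = 0"
    proof (rule ccontr)
      assume xk: "x $ k \<noteq> 0"
      have "B *\<^sub>v ((- 1 / x $ k) \<cdot>\<^sub>v r x) = w"
      proof (rule eq_vecI)
        fix i assume "i < dim_vec w"
        then have i: "i < n" using w by simp
        have "(B *\<^sub>v r x + x $ k \<cdot>\<^sub>v w) $ i = 0" unfolding 0 using i by simp
        then have "(B *\<^sub>v r x) $ i = - (x $ k * w $ i)"
          using i w by (simp add: add_eq_0_iff2 del: index_mult_mat_vec)
        then show "(B *\<^sub>v ((- 1 / x $ k) \<cdot>\<^sub>v r x)) $ i = w $ i"
          using i B(2) xk by (subst mult_mat_vec[OF B(2) r]) (simp del: index_mult_mat_vec)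
      qed (use B w in auto)
      then show False using notin[of "(- 1 / x $ k) \<cdot>\<^sub>v r x"] by simp
    qed
    have "B *\<^sub>v r x = 0\<^sub>v n"
    proof (rule eq_vecI)
      fix i assume "i < dim_vec (0\<^sub>v n :: complex vec)"
      then have i: "i < n" by simp
      have "(B *\<^sub>v r x + x $ k \<cdot>\<^sub>v w) $ i = 0" unfolding 0 using i by simp
      then show "(B *\<^sub>v r x) $ i = 0\<^sub>v n $ i" using xk i w by (simp del: index_mult_mat_vec)
    qed (use B in auto)
    then have "r x = 0\<^sub>v k" by (rule mat_injD[OF B r])
    then have "r x $ i = 0" if "i < k" for i using that by simp
    then have "x $ i = 0" if "i < k" for i using that by (simp add: r_def)
    then show "x = 0\<^sub>v (Suc k)" using x xk by (intro eq_vecI) (auto simp: less_Suc_eq)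
  qed
  moreover have "\<forall>x\<in>carrier_vec (Suc k). \<exists>y\<in>carrier_vec k. \<exists>c. B' *\<^sub>v x = B *\<^sub>v y + c \<cdot>\<^sub>v w"
    using split r by blast
  ultimately show ?thesis using B' by blast
qed

text \<open>A largest independent family of columns inside \<open>W\<close> spans \<open>W\<close>,
  since otherwise \<open>mat_inj_extend\<close> would enlarge it; \<open>mat_inj_le\<close> bounds
  the size. If \<open>k = n\<close>, a vector outside \<open>W\<close> would produce
  \<open>n + 1\<close> independent columns.\<close>

lemma subspace_basis_mat:
  assumes W: "W \<subseteq> carrier_vec n" and W0: "0\<^sub>v n \<in> W"
    and add: "\<And>v w. v \<in> W \<Longrightarrow> w \<in> W \<Longrightarrow> v + w \<in> W" and smult: "\<And>c w. w \<in> W \<Longrightarrow> c \<cdot>\<^sub>v w \<in> W"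
  obtains k B where "B \<in> carrier_mat n k" "mat_inj k B" "W = (\<lambda>x. B *\<^sub>v x) ` carrier_vec k"
    "k \<le> n" "k = n \<Longrightarrow> W = carrier_vec n"
proof -
  define Q where "Q k \<longleftrightarrow> (\<exists>B\<in>carrier_mat n k. mat_inj k B \<and> (\<forall>x\<in>carrier_vec k. B *\<^sub>v x \<in> W))" for k
  \<comment> \<open>The empty family, as a matrix without columns, starts the search for a largest
    one.\<close>
  have "Q 0"
  proof -
    have "mat n 0 (\<lambda>_. 0) *\<^sub>v x = 0\<^sub>v n" if "x \<in> carrier_vec 0" for x :: "complex vec"
      using that by (intro eq_vecI) (auto simp: scalar_prod_def)
    then show ?thesis unfolding Q_def using W0 by (intro bexI[of _ "mat n 0 (\<lambda>_. 0)"]) (auto simp: mat_inj_def)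
  qed
  moreover have bound: "k < Suc n" if "Q k" for k using that mat_inj_le unfolding Q_def by (meson less_Suc_eq_le)
  ultimately obtain k where k: "Q k" "\<And>j. Q j \<Longrightarrow> j \<le> k"
    using ex_has_greatest_nat[of Q 0 "\<lambda>k. k" "Suc n"] by auto
  obtain B where B: "B \<in> carrier_mat n k" "mat_inj k B" "\<And>x. x \<in> carrier_vec k \<Longrightarrow> B *\<^sub>v x \<in> W"
    using k(1) by (auto simp: Q_def)
  have "\<exists>x\<in>carrier_vec k. B *\<^sub>v x = w" if w: "w \<in> W" for w
  proof (rule ccontr)
    assume "\<not> ?thesis"
    then obtain B' where B': "B' \<in> carrier_mat n (Suc k)" "mat_inj (Suc k) B'"
      "\<forall>x\<in>carrier_vec (Suc k). \<exists>y\<in>carrier_vec k. \<exists>c. B' *\<^sub>v x = B *\<^sub>v y + c \<cdot>\<^sub>v w"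
      using mat_inj_extend[OF B(2,1), of w] w W by blast
    have "B' *\<^sub>v x \<in> W" if "x \<in> carrier_vec (Suc k)" for x
      using B'(3) that B(3) add smult w by metis
    then have "Q (Suc k)" using B' by (auto simp: Q_def)
    then show False using k(2) by fastforce
  qed
  then have im: "W = (\<lambda>x. B *\<^sub>v x) ` carrier_vec k" using B(3) by (auto simp: image_iff)
  have kn: "k \<le> n" using bound[OF k(1)] by simp
  have "W = carrier_vec n" if "k = n"
  proof (rule ccontr)
    assume "W \<noteq> carrier_vec n"
    then obtain w where w: "w \<in> carrier_vec n" "w \<notin> W" using W by blast
    have "B *\<^sub>v x \<noteq> w" if "x \<in> carrier_vec k" for x using B(3)[OF that] w by auto
    from mat_inj_extend[OF B(2,1) w(1) this] obtain B' where "B' \<in> carrier_mat n (Suc k)" "mat_inj (Suc k) B'"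
      by blast
    then show False using mat_inj_le \<open>k = n\<close> by fastforce
  qed
  with that B(1,2) im kn show ?thesis by blast
qed

text \<open>The inner product of P P^* y with y is the squared norm of P^* y.\<close>

lemma adjoint_mat_mult_vec_eq_zero:
  assumes P: "P \<in> carrier_mat n n" and y: "y \<in> carrier_vec n"
    and 0: "P *\<^sub>v (adjoint_mat P *\<^sub>v y) = 0\<^sub>v n"
  shows "adjoint_mat P *\<^sub>v y = 0\<^sub>v n"
proof -
  define u where "u = adjoint_mat P *\<^sub>v y"
  have aP: "adjoint_mat P \<in> carrier_mat n n" using P by simp
  have u: "u \<in> carrier_vec n" using mult_mat_vec_carrier[OF aP y] by (simp add: u_def)
  have uj: "cnj (u $ j) = (\<Sum>i<n. P $$ (i, j) * cnj (y $ i))" if j: "j < n" for j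
    unfolding u_def index_mult_mat_vec_sum[OF aP y j] using P j by (simp add: adjoint_mat_def)
  have "complex_of_real (\<Sum>j<n. (cmod (u $ j))\<^sup>2) = (\<Sum>j<n. u $ j * cnj (u $ j))"
    by (simp only: of_real_sum complex_norm_square)
  also have "\<dots> = (\<Sum>j<n. \<Sum>i<n. cnj (y $ i) * (P $$ (i, j) * u $ j))"
    by (intro sum.cong refl) (simp add: uj sum_distrib_left mult_ac)
  also have "\<dots> = (\<Sum>i<n. cnj (y $ i) * (P *\<^sub>v u) $ i)"
    by (subst sum.swap, intro sum.cong refl)
      (simp add: index_mult_mat_vec_sum[OF P u] sum_distrib_left del: index_mult_mat_vec)
  also have "\<dots> = 0" using 0 by (simp add: u_def[symmetric])
  finally have "(\<Sum>j<n. (cmod (u $ j))\<^sup>2) = 0" by (simp only: of_real_eq_0_iff)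
  then have "\<forall>j<n. u $ j = 0" by (subst (asm) sum_nonneg_eq_0_iff) auto
  then show ?thesis unfolding u_def[symmetric] using u by (intro eq_vecI) auto
qed

section \<open>Character theory of finite groups\<close>

text \<open>The image of \<open>A\<close> is invariant under \<open>R\<close> and nonzero, hence
  everything. Irreducibility is asked of \<open>R\<close> alone, because \<open>trace_inv\<close>
  applies this to a \<open>T\<close> about whose irreducibility nothing has been shown.\<close>

lemma intertwiner_surj:
  assumes R: "irreducible_rep G n R" and A: "A \<in> carrier_mat n m" "A \<noteq> 0\<^sub>m n m"
    and T: "\<And>g. g \<in> carrier G \<Longrightarrow> T g \<in> carrier_mat m m"
    and eq: "\<And>g. g \<in> carrier G \<Longrightarrow> R g * A = A * T g"
  shows "\<exists>C\<in>carrier_mat m n. A * C = 1\<^sub>m n"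
proof -
  define W where "W = {A *\<^sub>v v | v. v \<in> carrier_vec m}"
  have Rc: "\<And>g. g \<in> carrier G \<Longrightarrow> R g \<in> carrier_mat n n"
    using R by (auto simp: irreducible_rep_def is_rep_def)
  have "invariant_subspace G n R W"
    unfolding invariant_subspace_def
  proof (intro conjI ballI allI)
    show "W \<subseteq> carrier_vec n" using A by (auto simp: W_def)
    show "0\<^sub>v n \<in> W" unfolding W_def using mult_mat_zero_vec[OF A(1), symmetric] zero_carrier_vec by blast
    show "v + w \<in> W" if vw: "v \<in> W" "w \<in> W" for v w
    proof -
      obtain x y where xy: "x \<in> carrier_vec m" "y \<in> carrier_vec m" "v = A *\<^sub>v x" "w = A *\<^sub>v y"
        using vw by (auto simp: W_def)
      then have "v + w = A *\<^sub>v (x + y)" using A by (simp add: mult_add_distrib_mat_vec[of _ n m])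
      moreover have "x + y \<in> carrier_vec m" using xy by simp
      ultimately show ?thesis unfolding W_def by blast
    qed
    show "c \<cdot>\<^sub>v w \<in> W" if w: "w \<in> W" for c w
    proof -
      obtain x where x: "x \<in> carrier_vec m" "w = A *\<^sub>v x" using w by (auto simp: W_def)
      then have "c \<cdot>\<^sub>v w = A *\<^sub>v (c \<cdot>\<^sub>v x)" using A by (simp add: mult_mat_vec[of _ n m])
      moreover have "c \<cdot>\<^sub>v x \<in> carrier_vec m" using x by simp
      ultimately show ?thesis unfolding W_def by blast
    qed
    show "R g *\<^sub>v w \<in> W" if g: "g \<in> carrier G" and w: "w \<in> W" for g w
    proof -
      obtain v where v: "v \<in> carrier_vec m" "w = A *\<^sub>v v" using w by (auto simp: W_def)
      have "R g *\<^sub>v w = (R g * A) *\<^sub>v v" using v A Rc[OF g] by simp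
      also have "\<dots> = A *\<^sub>v (T g *\<^sub>v v)" using v A T[OF g] by (simp add: eq[OF g])
      finally have "R g *\<^sub>v w = A *\<^sub>v (T g *\<^sub>v v)" .
      moreover have "T g *\<^sub>v v \<in> carrier_vec m" using T[OF g] v by simp
      ultimately show ?thesis unfolding W_def by blast
    qed
  qed
  then have "W = {0\<^sub>v n} \<or> W = carrier_vec n" using R by (auto simp: irreducible_rep_def)
  moreover have "W \<noteq> {0\<^sub>v n}"
  proof
    assume *: "W = {0\<^sub>v n}"
    have "A = 0\<^sub>m n m"
    proof (rule mat_vec_ext[OF A(1)])
      fix v :: "complex vec" assume v: "v \<in> carrier_vec m"
      then have "A *\<^sub>v v \<in> W" by (auto simp: W_def)
      then show "A *\<^sub>v v = 0\<^sub>m n m *\<^sub>v v" using * v by (simp add: zero_mat_mult_vec)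
    qed auto
    with A show False by simp
  qed
  ultimately have "W = carrier_vec n" by simp
  then have "\<exists>v\<in>carrier_vec m. A *\<^sub>v v = w" if "w \<in> carrier_vec n" for w
  proof -
    have "w \<in> W" using that \<open>W = carrier_vec n\<close> by simp
    then show ?thesis by (auto simp: W_def)
  qed
  then show ?thesis by (intro mat_factor_left[OF A(1)]) auto
qed

text \<open>The kernel of \<open>A\<close> is invariant under \<open>T\<close> and proper, hence
  zero.\<close>

lemma intertwiner_inj:
  assumes T: "irreducible_rep G m T" and A: "A \<in> carrier_mat n m" "A \<noteq> 0\<^sub>m n m"
    and R: "\<And>g. g \<in> carrier G \<Longrightarrow> R g \<in> carrier_mat n n"
    and eq: "\<And>g. g \<in> carrier G \<Longrightarrow> R g * A = A * T g"
    and v: "v \<in> carrier_vec m" "A *\<^sub>v v = 0\<^sub>v n"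
  shows "v = 0\<^sub>v m"
proof -
  define W where "W = {v \<in> carrier_vec m. A *\<^sub>v v = 0\<^sub>v n}"
  have Tc: "\<And>g. g \<in> carrier G \<Longrightarrow> T g \<in> carrier_mat m m"
    using T by (auto simp: irreducible_rep_def is_rep_def)
  have "invariant_subspace G m T W"
    unfolding invariant_subspace_def
  proof (intro conjI ballI allI)
    show "W \<subseteq> carrier_vec m" "0\<^sub>v m \<in> W" using mult_mat_zero_vec[OF A(1)] by (auto simp: W_def)
    show "v + w \<in> W" if "v \<in> W" "w \<in> W" for v w
      using that A unfolding W_def by (auto simp: mult_add_distrib_mat_vec[of _ n m])
    show "c \<cdot>\<^sub>v w \<in> W" if "w \<in> W" for c w
      using that A unfolding W_def by (auto simp: mult_mat_vec[of _ n m])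
    show "T g *\<^sub>v w \<in> W" if g: "g \<in> carrier G" and w: "w \<in> W" for g w
    proof -
      have w': "w \<in> carrier_vec m" "A *\<^sub>v w = 0\<^sub>v n" using w by (auto simp: W_def)
      have "A *\<^sub>v (T g *\<^sub>v w) = (R g * A) *\<^sub>v w"
        using w' A Tc[OF g] by (simp add: eq[OF g])
      also have "\<dots> = 0\<^sub>v n" using w' A R[OF g] by (simp add: mult_mat_zero_vec)
      finally show ?thesis using Tc[OF g] w' by (auto simp: W_def)
    qed
  qed
  then have "W = {0\<^sub>v m} \<or> W = carrier_vec m" using T by (auto simp: irreducible_rep_def)
  moreover have "W \<noteq> carrier_vec m"
  proof
    assume *: "W = carrier_vec m"
    have "A = 0\<^sub>m n m"
    proof (rule mat_vec_ext[OF A(1)])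
      fix v :: "complex vec" assume v: "v \<in> carrier_vec m"
      then have "v \<in> W" using * by simp
      then show "A *\<^sub>v v = 0\<^sub>m n m *\<^sub>v v" using v by (simp add: W_def zero_mat_mult_vec)
    qed auto
    with A show False by simp
  qed
  ultimately show ?thesis using v by (auto simp: W_def)
qed

text \<open>The conclusion concerns traces rather than equivalence because \<open>Irr\<close>
  collects characters as functions: representations with distinct characters then admit no nonzero
  intertwiner.\<close>

theorem Schur_trace_eq:
  assumes R: "irreducible_rep G n R" and T: "irreducible_rep G m T"
    and A: "A \<in> carrier_mat n m" "A \<noteq> 0\<^sub>m n m"
    and eq: "\<And>g. g \<in> carrier G \<Longrightarrow> R g * A = A * T g" and g: "g \<in> carrier G"
  shows "mat_trace (R g) = mat_trace (T g)"
proof -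
  have Rc: "\<And>g. g \<in> carrier G \<Longrightarrow> R g \<in> carrier_mat n n"
    and Tc: "\<And>g. g \<in> carrier G \<Longrightarrow> T g \<in> carrier_mat m m"
    using R T by (auto simp: irreducible_rep_def is_rep_def)
  obtain C where C: "C \<in> carrier_mat m n" "A * C = 1\<^sub>m n"
    using intertwiner_surj[OF R A Tc eq] by blast
  \<comment> \<open>The right inverse is also a left inverse: \<open>A\<close> kills C A v - v and
    is injective.\<close>
  have "C * A = 1\<^sub>m m"
  proof (rule mat_vec_ext)
    fix v :: "complex vec" assume v: "v \<in> carrier_vec m"
    have "A *\<^sub>v (C *\<^sub>v (A *\<^sub>v v)) = (A * C) *\<^sub>v (A *\<^sub>v v)"
      using A(1) C(1) v by (simp del: C(2))
    then have "A *\<^sub>v (C *\<^sub>v (A *\<^sub>v v) - v) = 0\<^sub>v n"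
      using A C v by (simp add: mult_minus_distrib_mat_vec[of _ n m])
    then have "C *\<^sub>v (A *\<^sub>v v) - v = 0\<^sub>v m"
      by (intro intertwiner_inj[OF T A Rc eq]) (use A C v in auto)
    then have "C *\<^sub>v (A *\<^sub>v v) = v" 
      by (rule minus_vec_eq_zeroD[rotated 2]) (use A C v in auto)
    then show "C * A *\<^sub>v v = 1\<^sub>m m *\<^sub>v v" using A C v by simp
  qed (use A C in auto)
  from mat_trace_eq_of_intertwiner[OF A(1) C this Rc[OF g] Tc[OF g] eq[OF g]] show ?thesis .
qed

text \<open>An eigenvector for \<open>c\<close> lies in the kernel of the intertwiner A - c I, which
  is therefore not injective and must be zero. The eigenvalue exists over the complex numbers as
  \<open>n > 0\<close>.\<close>

theorem Schur_scalar:
  assumes R: "irreducible_rep G n R" and A: "A \<in> carrier_mat n n"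
    and eq: "\<And>g. g \<in> carrier G \<Longrightarrow> R g * A = A * R g"
  shows "\<exists>c. A = c \<cdot>\<^sub>m 1\<^sub>m n"
proof -
  have Rc: "\<And>g. g \<in> carrier G \<Longrightarrow> R g \<in> carrier_mat n n" and n: "n > 0"
    using R by (auto simp: irreducible_rep_def is_rep_def)
  obtain c where "eigenvalue A c" using spectrum_non_empty[OF A n] by (auto simp: spectrum_def)
  then obtain v where v: "v \<in> carrier_vec n" "v \<noteq> 0\<^sub>v n" "A *\<^sub>v v = c \<cdot>\<^sub>v v"
    using A by (auto simp: eigenvalue_def eigenvector_def)
  define B where "B = A - c \<cdot>\<^sub>m 1\<^sub>m n"
  have B: "B \<in> carrier_mat n n" unfolding B_def by (rule minus_carrier_mat) simp
  have "B *\<^sub>v v = 0\<^sub>v n"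
    using v A unfolding B_def by (subst minus_mult_distrib_mat_vec[of _ n n]) (auto simp: smult_mat_mult_vec)
  moreover have "R g * B = B * R g" if g: "g \<in> carrier G" for g
    using eq[OF g] Rc[OF g] A unfolding B_def
    by (simp add: mult_minus_distrib_mat[of _ n n] minus_mult_distrib_mat[of _ n n] 
      mult_smult_distrib[of _ n n _ n] mult_smult_assoc_mat[of _ n n _ n])
  ultimately have "B = 0\<^sub>m n n"
    using intertwiner_inj[of G n R B n R v] R B Rc v(1,2) by metis
  have "A = c \<cdot>\<^sub>m 1\<^sub>m n"
  proof (rule eq_matI)
    fix i j assume "i < dim_row (c \<cdot>\<^sub>m 1\<^sub>m n)" "j < dim_col (c \<cdot>\<^sub>m 1\<^sub>m n)"
    then have ij: "i < n" "j < n" by auto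
    then have "B $$ (i, j) = 0" using \<open>B = 0\<^sub>m n n\<close> by simp
    then show "A $$ (i, j) = (c \<cdot>\<^sub>m 1\<^sub>m n) $$ (i, j)" using ij A by (simp add: B_def)
  qed (use A in auto)
  then show ?thesis by blast
qed

section \<open>Averaging and orthonormality of characters\<close>

locale fin_group = group G for G (structure) +
  assumes finite_carrier: "finite (carrier G)"
begin

lemma card_carrier_pos: "card (carrier G) > 0"
  using finite_carrier card_gt_0_iff one_closed by blast

lemma rep_carrier: "is_rep G n R \<Longrightarrow> g \<in> carrier G \<Longrightarrow> R g \<in> carrier_mat n n"
  and rep_mult: "is_rep G n R \<Longrightarrow> g \<in> carrier G \<Longrightarrow> h \<in> carrier G \<Longrightarrow> R (g \<otimes> h) = R g * R h"
  and rep_one: "is_rep G n R \<Longrightarrow> R \<one> = 1\<^sub>m n"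
  by (auto simp: is_rep_def)

lemma irreducible_is_rep: "irreducible_rep G n R \<Longrightarrow> is_rep G n R"
  and irreducible_dim_pos: "irreducible_rep G n R \<Longrightarrow> n > 0"
  by (auto simp: irreducible_rep_def)

lemma rep_inv_mult:
  assumes "is_rep G n R" "g \<in> carrier G"
  shows "R (inv g) * R g = 1\<^sub>m n" "R g * R (inv g) = 1\<^sub>m n"
  using assms by (metis inv_closed l_inv r_inv rep_mult rep_one)+

lemma bij_betw_mult_left: "h \<in> carrier G \<Longrightarrow> bij_betw (\<lambda>g. h \<otimes> g) (carrier G) (carrier G)"
  by (rule bij_betw_byWitness[where f' = "\<lambda>g. inv h \<otimes> g"]) (auto simp: m_assoc[symmetric])

lemma bij_betw_conj: "h \<in> carrier G \<Longrightarrow> bij_betw (\<lambda>g. inv h \<otimes> g \<otimes> h) (carrier G) (carrier G)"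
proof (rule bij_betw_byWitness[where f' = "\<lambda>g. h \<otimes> g \<otimes> inv h"])
  assume h: "h \<in> carrier G"
  have *: "inv h \<otimes> (h \<otimes> g \<otimes> inv h) \<otimes> h = g" "h \<otimes> (inv h \<otimes> g \<otimes> h) \<otimes> inv h = g"
    if "g \<in> carrier G" for g
    using h that by (simp_all add: m_assoc) (simp_all add: m_assoc[symmetric])
  then show "\<forall>a\<in>carrier G. h \<otimes> (inv h \<otimes> a \<otimes> h) \<otimes> inv h = a"
    and "\<forall>a'\<in>carrier G. inv h \<otimes> (h \<otimes> a' \<otimes> inv h) \<otimes> h = a'" by auto
qed auto

text \<open>The usual averaging of a matrix into an intertwiner, without division by the group
  order; that factor reappears as the value in \<open>trace_normalized\<close>.\<close>

definition rep_avg :: "nat \<Rightarrow> nat \<Rightarrow> ('a \<Rightarrow> complex mat) \<Rightarrow> ('a \<Rightarrow> complex mat) \<Rightarrow> complex mat \<Rightarrow> complex mat" where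
  "rep_avg n m R T A = mat_sum n m (carrier G) (\<lambda>g. R g * A * T (inv g))"

lemma rep_avg_carrier [simp]: "rep_avg n m R T A \<in> carrier_mat n m"
  by (simp add: rep_avg_def)

text \<open>Substituting \<open>h \<otimes> g\<close> for \<open>g\<close> in the average turns the
  factor \<open>T h\<close> on the right into \<open>R h\<close> on the left.\<close>

lemma rep_avg_intertwines:
  assumes R: "is_rep G n R" and T: "is_rep G m T" and A: "A \<in> carrier_mat n m" and h: "h \<in> carrier G"
  shows "R h * rep_avg n m R T A = rep_avg n m R T A * T h"
proof -
  note c = rep_carrier[OF R] rep_carrier[OF T]
  have term_eq: "R (h \<otimes> g) * A * T (inv (h \<otimes> g)) * T h = R h * (R g * A * T (inv g))"
    if g: "g \<in> carrier G" for g
  proof -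
    have "T (inv (h \<otimes> g)) * T h = T (inv (h \<otimes> g) \<otimes> h)" using g h by (simp add: rep_mult[OF T])
    also have "inv (h \<otimes> g) \<otimes> h = inv g" using g h by (simp add: inv_mult_group m_assoc)
    finally have *: "T (inv (h \<otimes> g)) * T h = T (inv g)" .
    have "R (h \<otimes> g) * A * T (inv (h \<otimes> g)) * T h = R (h \<otimes> g) * A * (T (inv (h \<otimes> g)) * T h)"
      by (rule assoc_mult_mat[of _ n m _ m _ m]) (use A c g h in \<open>auto intro!: mult_carrier_mat\<close>)
    also have "\<dots> = R h * R g * A * T (inv g)" unfolding * using rep_mult[OF R h g] by simp
    also have "\<dots> = R h * (R g * A * T (inv g))"
      using A c(1)[OF g] c(1)[OF h] c(2)[of "inv g"] g
      by (simp add: assoc_mult_mat[of _ n n _ n _ m] assoc_mult_mat[of _ n n _ m _ m])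
    finally show ?thesis .
  qed
  have "rep_avg n m R T A * T h = mat_sum n m (carrier G) (\<lambda>g. R g * A * T (inv g) * T h)"
    unfolding rep_avg_def by (rule mat_sum_mult) (use A c h in \<open>auto intro!: mult_carrier_mat\<close>)
  also have "\<dots> = mat_sum n m (carrier G) (\<lambda>g. R (h \<otimes> g) * A * T (inv (h \<otimes> g)) * T h)"
    by (rule mat_sum_reindex_bij_betw[OF bij_betw_mult_left[OF h], symmetric])
  also have "\<dots> = mat_sum n m (carrier G) (\<lambda>g. R h * (R g * A * T (inv g)))"
    by (rule mat_sum_cong[OF refl term_eq])
  also have "\<dots> = R h * rep_avg n m R T A"
    unfolding rep_avg_def by (rule mult_mat_sum[symmetric]) (use A c h in \<open>auto intro!: mult_carrier_mat\<close>)
  finally show ?thesis by simp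
qed

lemma index_rep_avg_unit_mat:
  assumes R: "is_rep G n R" and T: "is_rep G m T" and "i < n" "a < n" "b < m" "j < m"
  shows "rep_avg n m R T (unit_mat n m a b) $$ (i, j) = (\<Sum>g\<in>carrier G. R g $$ (i, a) * T (inv g) $$ (b, j))"
proof -
  have "rep_avg n m R T (unit_mat n m a b) $$ (i, j) =
      (\<Sum>g\<in>carrier G. (R g * unit_mat n m a b * T (inv g)) $$ (i, j))"
    using assms by (simp add: rep_avg_def)
  also have "\<dots> = (\<Sum>g\<in>carrier G. R g $$ (i, a) * T (inv g) $$ (b, j))"
    using assms by (intro sum.cong refl index_mult_unit_mat_mult) (auto intro: rep_carrier)
  finally show ?thesis .
qed

text \<open>With \<open>inv\<close> in place of complex conjugation, the left side is the
  unnormalized inner product of two characters. The expansion into averages of matrix units makes it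
  accessible to Schur's lemma.\<close>

lemma sum_trace_mult_trace:
  assumes R: "is_rep G n R" and T: "is_rep G m T"
  shows "(\<Sum>g\<in>carrier G. mat_trace (R g) * mat_trace (T (inv g))) =
    (\<Sum>a<n. \<Sum>b<m. rep_avg n m R T (unit_mat n m a b) $$ (a, b))"
proof -
  have "(\<Sum>g\<in>carrier G. mat_trace (R g) * mat_trace (T (inv g))) =
      (\<Sum>g\<in>carrier G. \<Sum>a<n. \<Sum>b<m. R g $$ (a, a) * T (inv g) $$ (b, b))"
    by (intro sum.cong refl)
      (simp add: mat_trace_eq_sum[OF rep_carrier[OF R]] mat_trace_eq_sum[OF rep_carrier[OF T]] sum_product)
  also have "\<dots> = (\<Sum>a<n. \<Sum>b<m. \<Sum>g\<in>carrier G. R g $$ (a, a) * T (inv g) $$ (b, b))"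
    by (subst sum.swap, intro sum.cong refl sum.swap)
  also have "\<dots> = (\<Sum>a<n. \<Sum>b<m. rep_avg n m R T (unit_mat n m a b) $$ (a, b))"
    by (intro sum.cong refl) (simp add: index_rep_avg_unit_mat[OF R T])
  finally show ?thesis .
qed

text \<open>A nonzero average would be a nonzero intertwiner and force equal traces at
  \<open>h\<close>, so all averages vanish.\<close>

lemma trace_orthogonal:
  assumes R: "irreducible_rep G n R" and T: "irreducible_rep G m T"
    and ne: "h \<in> carrier G" "mat_trace (R h) \<noteq> mat_trace (T h)"
  shows "(\<Sum>g\<in>carrier G. mat_trace (R g) * mat_trace (T (inv g))) = 0"
proof -
  note rep = irreducible_is_rep[OF R] irreducible_is_rep[OF T]
  have "rep_avg n m R T A = 0\<^sub>m n m" if "A \<in> carrier_mat n m" for A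
    using Schur_trace_eq[OF R T rep_avg_carrier _ rep_avg_intertwines[OF rep that] ne(1)] ne(2) by blast
  then show ?thesis by (simp add: sum_trace_mult_trace[OF rep])
qed

text \<open>The average of the matrix unit at \<open>(a, b)\<close> is a scalar matrix c I.
  Comparing traces gives c n = |G| if a = b, and c = 0 otherwise, so each of the n diagonal units
  contributes |G|/n.\<close>

lemma trace_normalized:
  assumes R: "irreducible_rep G n R"
  shows "(\<Sum>g\<in>carrier G. mat_trace (R g) * mat_trace (R (inv g))) = of_nat (card (carrier G))"
proof -
  note rep = irreducible_is_rep[OF R]
  note n = irreducible_dim_pos[OF R]
  have entry: "rep_avg n n R R (unit_mat n n a b) $$ (a, b) =
      (if a = b then of_nat (card (carrier G)) / of_nat n else 0)" if ab: "a < n" "b < n" for a b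
  proof -
    let ?A = "unit_mat n n a b"
    obtain c where c: "rep_avg n n R R ?A = c \<cdot>\<^sub>m 1\<^sub>m n"
      using Schur_scalar[OF R rep_avg_carrier rep_avg_intertwines[OF rep rep unit_mat_carrier]] by blast
    have tr: "mat_trace (R g * ?A * R (inv g)) = mat_trace ?A" if g: "g \<in> carrier G" for g
    proof -
      have Rc: "R g \<in> carrier_mat n n" "R (inv g) \<in> carrier_mat n n" using g rep_carrier[OF rep] by auto
      have "mat_trace (R g * ?A * R (inv g)) = mat_trace (R (inv g) * (R g * ?A))"
        by (rule mat_trace_comm) (use Rc in auto)
      also have "R (inv g) * (R g * ?A) = R (inv g) * R g * ?A"
        by (rule assoc_mult_mat[symmetric, of _ n n _ n _ n]) (use Rc in auto)
      also have "\<dots> = ?A" unfolding rep_inv_mult[OF rep g] by (rule left_mult_one_mat[OF unit_mat_carrier])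
      finally show ?thesis .
    qed
    have "mat_trace (rep_avg n n R R ?A) = (\<Sum>g\<in>carrier G. mat_trace (R g * ?A * R (inv g)))"
      unfolding rep_avg_def by (rule mat_trace_mat_sum) (auto intro!: mult_carrier_mat rep_carrier[OF rep])
    also have "\<dots> = of_nat (card (carrier G)) * mat_trace ?A" by (simp add: tr)
    also have "mat_trace ?A = (\<Sum>i<n. if i = a then (if a = b then 1 else 0) else 0)"
      by (auto simp: mat_trace_def unit_mat_def intro!: sum.cong)
    also have "\<dots> = (if a = b then 1 else 0)" using ab by simp
    finally have "c * of_nat n = of_nat (card (carrier G)) * (if a = b then 1 else 0)"
      unfolding c by (subst (asm) mat_trace_smult[of _ n]) auto
    then have "c = of_nat (card (carrier G)) * (if a = b then 1 else 0) / of_nat n"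
      using n by (simp add: field_simps)
    then show ?thesis unfolding c using ab by auto
  qed
  have "(\<Sum>g\<in>carrier G. mat_trace (R g) * mat_trace (R (inv g))) =
      (\<Sum>a<n. \<Sum>b<n. if b = a then of_nat (card (carrier G)) / of_nat n else 0)"
    unfolding sum_trace_mult_trace[OF rep rep] by (intro sum.cong refl) (auto simp: entry)
  also have "\<dots> = of_nat (card (carrier G))" using n by simp
  finally show ?thesis .
qed

text \<open>The representation $g \mapsto R(g^{-1})^*$ has the character $g \mapsto \overline{\chi(g^{-1})}$; the positive
  matrix $\sum_g R(g) R(g)^*$ intertwines it with $R$.\<close>

lemma trace_inv:
  assumes R: "irreducible_rep G n R" and h: "h \<in> carrier G"
  shows "mat_trace (R (inv h)) = cnj (mat_trace (R h))"
proof -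
  note rep = irreducible_is_rep[OF R]
  note n = irreducible_dim_pos[OF R]
  define T where "T g = adjoint_mat (R (inv g))" for g
  have T: "is_rep G n T"
    unfolding is_rep_def
  proof (intro conjI ballI)
    show "T g \<in> carrier_mat n n" if "g \<in> carrier G" for g
      using that rep_carrier[OF rep] by (auto simp: T_def)
    show "T \<one> = 1\<^sub>m n" by (simp add: T_def rep_one[OF rep])
    show "T (g \<otimes> k) = T g * T k" if "g \<in> carrier G" "k \<in> carrier G" for g k
      using that rep_carrier[OF rep]
      by (simp add: T_def inv_mult_group rep_mult[OF rep] adjoint_mat_mult[of _ n n _ n])
  qed
  define A where "A = rep_avg n n R T (1\<^sub>m n)"
  have A: "A \<in> carrier_mat n n" by (simp add: A_def)
  have eq: "\<And>g. g \<in> carrier G \<Longrightarrow> R g * A = A * T g"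
    unfolding A_def by (rule rep_avg_intertwines[OF rep T]) auto
  have "A \<noteq> 0\<^sub>m n n"
  proof
    assume A0: "A = 0\<^sub>m n n"
    \<comment> \<open>This entry is a sum of squared absolute values over the group, and the term of
      \<open>\<one>\<close> is at least 1.\<close>
    have "A $$ (0, 0) = (\<Sum>g\<in>carrier G. (R g * adjoint_mat (R g)) $$ (0, 0))"
      using n unfolding A_def rep_avg_def T_def
      by (simp, intro sum.cong) (auto simp: right_mult_one_mat[OF rep_carrier[OF rep]] simp del: index_mult_mat)
    also have "\<dots> = (\<Sum>g\<in>carrier G. of_real (\<Sum>l<n. (cmod (R g $$ (0, l)))\<^sup>2))"
    proof (rule sum.cong[OF refl])
      fix g assume g: "g \<in> carrier G"
      have "(R g * adjoint_mat (R g)) $$ (0, 0) = (\<Sum>l<n. R g $$ (0, l) * adjoint_mat (R g) $$ (l, 0))"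
        by (rule index_mult_mat_sum) (use rep_carrier[OF rep g] n in auto)
      also have "\<dots> = (\<Sum>l<n. of_real ((cmod (R g $$ (0, l)))\<^sup>2))"
        using rep_carrier[OF rep g] n
        by (intro sum.cong refl) (auto simp: complex_norm_square[symmetric])
      finally show "(R g * adjoint_mat (R g)) $$ (0, 0) = of_real (\<Sum>l<n. (cmod (R g $$ (0, l)))\<^sup>2)" by simp
    qed
    also have "\<dots> = of_real (\<Sum>g\<in>carrier G. \<Sum>l<n. (cmod (R g $$ (0, l)))\<^sup>2)" by simp
    finally have "complex_of_real (\<Sum>g\<in>carrier G. \<Sum>l<n. (cmod (R g $$ (0, l)))\<^sup>2) = A $$ (0, 0)" by (rule sym)
    also have "\<dots> = 0" using A0 n by simp
    finally have "(\<Sum>g\<in>carrier G. \<Sum>l<n. (cmod (R g $$ (0, l)))\<^sup>2) = 0" by (simp only: of_real_eq_0_iff)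
    moreover have "(cmod (R \<one> $$ (0, 0)))\<^sup>2 \<le> (\<Sum>l<n. (cmod (R \<one> $$ (0, l)))\<^sup>2)"
      by (rule member_le_sum[of 0 "{..<n}" "\<lambda>l. (cmod (R \<one> $$ (0, l)))\<^sup>2"]) (use n in auto)
    moreover have "(\<Sum>l<n. (cmod (R \<one> $$ (0, l)))\<^sup>2) \<le> (\<Sum>g\<in>carrier G. \<Sum>l<n. (cmod (R g $$ (0, l)))\<^sup>2)"
      by (rule member_le_sum[of \<one> "carrier G" "\<lambda>g. \<Sum>l<n. (cmod (R g $$ (0, l)))\<^sup>2"]) (auto intro: sum_nonneg simp: finite_carrier)
    ultimately show False using n by (simp add: rep_one[OF rep])
  qed
  from intertwiner_surj[OF R A this rep_carrier[OF T] eq]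
  obtain C where C: "C \<in> carrier_mat n n" "A * C = 1\<^sub>m n" by blast
  from mat_mult_left_right_inverse[OF A C] have "C * A = 1\<^sub>m n" .
  from mat_trace_eq_of_intertwiner[OF A C this rep_carrier[OF rep h] rep_carrier[OF T h] eq[OF h]]
  have "mat_trace (R h) = mat_trace (T h)" .
  also have "\<dots> = cnj (mat_trace (R (inv h)))"
    using rep_carrier[OF rep, of "inv h"] h by (simp add: T_def mat_trace_adjoint)
  finally show ?thesis by simp
qed

lemma IrrI: "irreducible_rep G n R \<Longrightarrow> (\<lambda>g\<in>carrier G. mat_trace (R g)) \<in> Irr G"
  unfolding Irr_def by blast

lemma IrrE:
  assumes "\<chi> \<in> Irr G"
  obtains n R where "irreducible_rep G n R" "\<chi> = (\<lambda>g\<in>carrier G. mat_trace (R g))"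
  using assms by (auto simp: Irr_def)

lemma Irr_ext: "\<chi> \<in> Irr G \<Longrightarrow> \<psi> \<in> Irr G \<Longrightarrow> (\<And>g. g \<in> carrier G \<Longrightarrow> \<chi> g = \<psi> g) \<Longrightarrow> \<chi> = \<psi>"
  by (elim IrrE) (auto simp: fun_eq_iff restrict_def)

lemma Irr_conj:
  assumes "\<chi> \<in> Irr G" and g: "g \<in> carrier G" and h: "h \<in> carrier G"
  shows "\<chi> (inv h \<otimes> g \<otimes> h) = \<chi> g"
  using assms(1)
proof (rule IrrE)
  fix n R assume R: "irreducible_rep G n R" and \<chi>: "\<chi> = (\<lambda>g\<in>carrier G. mat_trace (R g))"
  note rep = irreducible_is_rep[OF R]
  have c: "R g \<in> carrier_mat n n" "R h \<in> carrier_mat n n" "R (inv h) \<in> carrier_mat n n"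
    using g h rep_carrier[OF rep] by auto
  have "R (inv h \<otimes> g \<otimes> h) = R (inv h) * R g * R h" using g h by (simp add: rep_mult[OF rep])
  also have "mat_trace \<dots> = mat_trace (R h * (R (inv h) * R g))" by (rule mat_trace_comm) (use c in auto)
  also have "R h * (R (inv h) * R g) = R h * R (inv h) * R g"
    by (rule assoc_mult_mat[symmetric, of _ n n _ n _ n]) (use c in auto)
  also have "\<dots> = R g" unfolding rep_inv_mult[OF rep h] using c by simp
  finally show ?thesis using g h by (simp add: \<chi>)
qed

lemma Irr_one_ge_1: "\<chi> \<in> Irr G \<Longrightarrow> cmod (\<chi> \<one>) \<ge> 1"
  by (elim IrrE) (auto dest: irreducible_dim_pos simp: rep_one[OF irreducible_is_rep])

theorem Irr_orthonormal:
  assumes "\<chi> \<in> Irr G" "\<psi> \<in> Irr G"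
  shows "(\<Sum>g\<in>carrier G. \<chi> g * cnj (\<psi> g)) = (if \<chi> = \<psi> then of_nat (card (carrier G)) else 0)"
proof -
  obtain n R where R: "irreducible_rep G n R" "\<chi> = (\<lambda>g\<in>carrier G. mat_trace (R g))"
    using assms(1) by (rule IrrE)
  obtain m T where T: "irreducible_rep G m T" "\<psi> = (\<lambda>g\<in>carrier G. mat_trace (T g))"
    using assms(2) by (rule IrrE)
  have eq: "(\<Sum>g\<in>carrier G. \<chi> g * cnj (\<psi> g)) = (\<Sum>g\<in>carrier G. mat_trace (R g) * mat_trace (T (inv g)))"
    by (intro sum.cong refl) (simp add: R(2) T(2) trace_inv[OF T(1)])
  show ?thesis
  proof (cases "\<chi> = \<psi>")
    case True
    \<comment> \<open>Equal characters may come from different representations \<open>R\<close> and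
      \<open>T\<close>, so the trace is transported before \<open>trace_normalized\<close>
      applies.\<close>
    have "(\<Sum>g\<in>carrier G. mat_trace (R g) * mat_trace (T (inv g))) =
        (\<Sum>g\<in>carrier G. mat_trace (R g) * mat_trace (R (inv g)))"
    proof (intro sum.cong refl arg_cong2[where f = "(*)"])
      fix g assume "g \<in> carrier G"
      then have "\<chi> (inv g) = \<psi> (inv g)" "inv g \<in> carrier G" using True by auto
      then show "mat_trace (T (inv g)) = mat_trace (R (inv g))" by (simp add: R(2) T(2))
    qed
    then show ?thesis using True eq trace_normalized[OF R(1)] by simp
  next
    case False
    then obtain h where "h \<in> carrier G" "\<chi> h \<noteq> \<psi> h" using Irr_ext[OF assms] by blast
    then show ?thesis using False eq trace_orthogonal[OF R(1) T(1), of h] by (simp add: R(2) T(2))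
  qed
qed


text \<open>Parseval's identity. It is restricted to a finite \<open>F\<close> because finiteness of
  \<open>Irr G\<close> is itself derived from it.\<close>

lemma sum_Irr_combination_norm:
  assumes F: "finite F" "F \<subseteq> Irr G"
  shows "(\<Sum>g\<in>carrier G. (cmod (\<Sum>\<chi>\<in>F. c \<chi> * \<chi> g))\<^sup>2) = card (carrier G) * (\<Sum>\<chi>\<in>F. (cmod (c \<chi>))\<^sup>2)"
proof -
  have "complex_of_real (\<Sum>g\<in>carrier G. (cmod (\<Sum>\<chi>\<in>F. c \<chi> * \<chi> g))\<^sup>2) =
      (\<Sum>g\<in>carrier G. \<Sum>\<chi>\<in>F. \<Sum>\<psi>\<in>F. c \<chi> * cnj (c \<psi>) * (\<chi> g * cnj (\<psi> g)))"
    unfolding of_real_sum complex_norm_square cnj_sum sum_product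
    by (intro sum.cong refl) (simp add: mult_ac)
  also have "\<dots> = (\<Sum>\<chi>\<in>F. \<Sum>\<psi>\<in>F. \<Sum>g\<in>carrier G. c \<chi> * cnj (c \<psi>) * (\<chi> g * cnj (\<psi> g)))"
    by (subst sum.swap, intro sum.cong refl sum.swap)
  also have "\<dots> = (\<Sum>\<chi>\<in>F. \<Sum>\<psi>\<in>F. if \<chi> = \<psi> then c \<chi> * cnj (c \<psi>) * card (carrier G) else 0)"
    unfolding sum_distrib_left[symmetric] using F(2)
    by (intro sum.cong refl) (subst Irr_orthonormal, auto)
  also have "\<dots> = of_real (card (carrier G) * (\<Sum>\<chi>\<in>F. (cmod (c \<chi>))\<^sup>2))"
    using F(1) by (simp only: sum.delta of_real_mult of_real_sum complex_norm_square sum_distrib_left of_real_of_nat_eq)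
      (simp add: mult_ac cong: if_cong)
  finally show ?thesis by (simp only: of_real_eq_iff)
qed

text \<open>For finite $F \subseteq \mathrm{Irr}(G)$ and $\varphi = \sum_{\chi \in F} \overline{\chi(1)} \chi$, compare $|\varphi(1)|^2$
  with $\sum_g |\varphi(g)|^2$.\<close>

lemma finite_Irr: "finite (Irr G)"
proof -
  have "card F \<le> card (carrier G)" if F: "F \<subseteq> Irr G" "finite F" for F
  proof -
    define s where "s = (\<Sum>\<chi>\<in>F. (cmod (\<chi> \<one>))\<^sup>2)"
    have "(\<Sum>\<chi>\<in>F. cnj (\<chi> \<one>) * \<chi> \<one>) = of_real s"
      unfolding s_def of_real_sum complex_norm_square by (simp add: mult.commute)
    then have "s\<^sup>2 = (cmod (\<Sum>\<chi>\<in>F. cnj (\<chi> \<one>) * \<chi> \<one>))\<^sup>2" by simp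
    \<comment> \<open>One term of a sum of squares is at most the sum. With Parseval this gives s^2
      \<le> |G| s, while degrees of at least 1 give \<open>card F \<le> s\<close>.\<close>
    also have "\<dots> \<le> (\<Sum>g\<in>carrier G. (cmod (\<Sum>\<chi>\<in>F. cnj (\<chi> \<one>) * \<chi> g))\<^sup>2)"
      by (rule member_le_sum) (auto simp: finite_carrier)
    also have "\<dots> = card (carrier G) * s"
      unfolding s_def by (subst sum_Irr_combination_norm[OF F(2,1)]) simp
    finally have le: "s * s \<le> card (carrier G) * s" by (simp add: power2_eq_square)
    have "real (card F) = (\<Sum>\<chi>\<in>F. 1)" by simp
    also have "\<dots> \<le> s" unfolding s_def
      using F(1) Irr_one_ge_1 by (intro sum_mono one_le_power) auto
    finally have card_le: "real (card F) \<le> s" .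
    have "s \<le> card (carrier G)"
    proof (cases "s > 0")
      case True then show ?thesis using le by simp
    next
      case False then show ?thesis using of_nat_0_le_iff[of "card (carrier G)"] by linarith
    qed
    then show ?thesis using card_le by linarith
  qed
  then show ?thesis using finite_if_finite_subsets_card_bdd by blast
qed

section \<open>Completeness of characters among class functions\<close>

text \<open>Conjugation invariance of \<open>f\<close> makes the sum commute with \<open>R\<close>,
  so it is scalar by Schur's lemma; its trace is the pairing of \<open>f\<close> with the character
  of \<open>R\<close>. The pairing carries no complex conjugation.\<close>

lemma class_sum_vanishes:
  assumes f: "\<And>g h. g \<in> carrier G \<Longrightarrow> h \<in> carrier G \<Longrightarrow> f (inv h \<otimes> g \<otimes> h) = f g"
    and orth: "\<And>\<chi>. \<chi> \<in> Irr G \<Longrightarrow> (\<Sum>g\<in>carrier G. f g * \<chi> g) = 0"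
    and R: "irreducible_rep G n R"
  shows "mat_sum n n (carrier G) (\<lambda>g. f g \<cdot>\<^sub>m R g) = 0\<^sub>m n n"
proof -
  note rep = irreducible_is_rep[OF R]
  note Rc = rep_carrier[OF rep]
  define M where "M = mat_sum n n (carrier G) (\<lambda>g. f g \<cdot>\<^sub>m R g)"
  have M: "M \<in> carrier_mat n n" by (simp add: M_def)
  have "R h * M = M * R h" if h: "h \<in> carrier G" for h
  proof -
    have "R h * M = mat_sum n n (carrier G) (\<lambda>g. R h * (f g \<cdot>\<^sub>m R g))"
      unfolding M_def by (rule mult_mat_sum) (use Rc h in auto)
    also have "\<dots> = mat_sum n n (carrier G) (\<lambda>g. R h * (f (inv h \<otimes> g \<otimes> h) \<cdot>\<^sub>m R (inv h \<otimes> g \<otimes> h)))"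
      by (rule mat_sum_reindex_bij_betw[OF bij_betw_conj[OF h], symmetric])
    also have "\<dots> = mat_sum n n (carrier G) (\<lambda>g. f g \<cdot>\<^sub>m R g * R h)"
    proof (rule mat_sum_cong[OF refl])
      fix g assume g: "g \<in> carrier G"
      have "R h * (f (inv h \<otimes> g \<otimes> h) \<cdot>\<^sub>m R (inv h \<otimes> g \<otimes> h)) = f g \<cdot>\<^sub>m (R h * R (inv h \<otimes> g \<otimes> h))"
        unfolding f[OF g h] by (rule mult_smult_distrib[of _ n n _ n]) (use Rc g h in auto)
      also have "R h * R (inv h \<otimes> g \<otimes> h) = R (h \<otimes> (inv h \<otimes> g \<otimes> h))"
        using g h by (simp add: rep_mult[OF rep])
      also have "h \<otimes> (inv h \<otimes> g \<otimes> h) = g \<otimes> h" using g h by (simp add: m_assoc[symmetric])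
      also have "f g \<cdot>\<^sub>m R (g \<otimes> h) = f g \<cdot>\<^sub>m R g * R h"
        unfolding rep_mult[OF rep g h] by (rule mult_smult_assoc_mat[OF Rc[OF g] Rc[OF h], symmetric])
      finally show "R h * (f (inv h \<otimes> g \<otimes> h) \<cdot>\<^sub>m R (inv h \<otimes> g \<otimes> h)) = f g \<cdot>\<^sub>m R g * R h" .
    qed
    also have "\<dots> = M * R h"
      unfolding M_def by (rule mat_sum_mult[symmetric]) (use Rc h in auto)
    finally show ?thesis .
  qed
  then obtain c where c: "M = c \<cdot>\<^sub>m 1\<^sub>m n" using Schur_scalar[OF R M] by blast
  have "c * of_nat n = mat_trace M" unfolding c by (subst mat_trace_smult[of _ n]) auto
  also have "\<dots> = (\<Sum>g\<in>carrier G. mat_trace (f g \<cdot>\<^sub>m R g))"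
    unfolding M_def by (rule mat_trace_mat_sum) (use Rc in auto)
  also have "\<dots> = (\<Sum>g\<in>carrier G. f g * (\<lambda>g\<in>carrier G. mat_trace (R g)) g)"
    by (intro sum.cong refl) (simp add: mat_trace_smult[OF Rc])
  also have "\<dots> = 0" by (rule orth[OF IrrI[OF R]])
  finally have "c = 0" using irreducible_dim_pos[OF R] by simp
  then show ?thesis unfolding M_def[symmetric] c by (intro eq_matI) auto
qed

text \<open>A kernel on the group as a matrix, through an enumeration \<open>e\<close> of the
  carrier. Products of such matrices are compositions of kernels, independent of the
  enumeration.\<close>

definition enum_mat :: "(nat \<Rightarrow> 'a) \<Rightarrow> ('a \<Rightarrow> 'a \<Rightarrow> complex) \<Rightarrow> complex mat" where
  "enum_mat e q = mat (card (carrier G)) (card (carrier G)) (\<lambda>(i, j). q (e i) (e j))"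

lemma enum_mat_carrier [simp]: "enum_mat e q \<in> carrier_mat (card (carrier G)) (card (carrier G))"
  by (simp add: enum_mat_def)

lemma enum_mat_cong:
  assumes "bij_betw e {..<card (carrier G)} (carrier G)"
    and "\<And>x y. x \<in> carrier G \<Longrightarrow> y \<in> carrier G \<Longrightarrow> p x y = q x y"
  shows "enum_mat e p = enum_mat e q"
  unfolding enum_mat_def using assms(2) bij_betw_apply[OF assms(1)] by (intro cong_mat) auto

lemma enum_mat_mult:
  assumes e: "bij_betw e {..<card (carrier G)} (carrier G)"
  shows "enum_mat e p * enum_mat e q = enum_mat e (\<lambda>x z. \<Sum>y\<in>carrier G. p x y * q y z)"
proof (rule eq_matI)
  let ?N = "card (carrier G)"
  fix i j assume "i < dim_row (enum_mat e (\<lambda>x z. \<Sum>y\<in>carrier G. p x y * q y z))"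
    "j < dim_col (enum_mat e (\<lambda>x z. \<Sum>y\<in>carrier G. p x y * q y z))"
  then have ij: "i < ?N" "j < ?N" by (auto simp: enum_mat_def)
  have "(enum_mat e p * enum_mat e q) $$ (i, j) = (\<Sum>l<?N. p (e i) (e l) * q (e l) (e j))"
    using ij by (subst index_mult_mat_sum[of _ ?N ?N _ ?N]) (auto simp: enum_mat_def)
  also have "\<dots> = (\<Sum>y\<in>carrier G. p (e i) y * q y (e j))" by (rule sum.reindex_bij_betw[OF e])
  finally show "(enum_mat e p * enum_mat e q) $$ (i, j) = enum_mat e (\<lambda>x z. \<Sum>y\<in>carrier G. p x y * q y z) $$ (i, j)"
    using ij by (simp add: enum_mat_def)
qed (auto simp: enum_mat_def)

definition regular_rep :: "(nat \<Rightarrow> 'a) \<Rightarrow> 'a \<Rightarrow> complex mat" where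
  "regular_rep e g = enum_mat e (\<lambda>x y. if x = g \<otimes> y then 1 else 0)"

lemma eq_mult_iff: "x \<in> carrier G \<Longrightarrow> y \<in> carrier G \<Longrightarrow> g \<in> carrier G \<Longrightarrow> x = g \<otimes> y \<longleftrightarrow> y = inv g \<otimes> x"
  using inv_solve_left[of y g x] by simp

text \<open>Multiplication by a translation matrix only shifts an argument of the kernel. Together
  with the lemma for the other side, commuting with the regular representation becomes an identity
  between kernel values.\<close>

lemma regular_rep_mult_enum_mat:
  assumes e: "bij_betw e {..<card (carrier G)} (carrier G)" and g: "g \<in> carrier G"
  shows "regular_rep e g * enum_mat e q = enum_mat e (\<lambda>x z. q (inv g \<otimes> x) z)"
  unfolding regular_rep_def enum_mat_mult[OF e]
proof (rule enum_mat_cong[OF e])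
  fix x z assume x: "x \<in> carrier G"
  have "(\<Sum>y\<in>carrier G. (if x = g \<otimes> y then 1 else 0) * q y z) =
      (\<Sum>y\<in>carrier G. if y = inv g \<otimes> x then q y z else 0)"
    using g by (intro sum.cong refl) (simp add: eq_mult_iff[OF x _ g])
  then show "(\<Sum>y\<in>carrier G. (if x = g \<otimes> y then 1 else 0) * q y z) = q (inv g \<otimes> x) z"
    using x g finite_carrier by simp
qed

lemma enum_mat_mult_regular_rep:
  assumes e: "bij_betw e {..<card (carrier G)} (carrier G)" and g: "g \<in> carrier G"
  shows "enum_mat e q * regular_rep e g = enum_mat e (\<lambda>x z. q x (g \<otimes> z))"
  unfolding regular_rep_def enum_mat_mult[OF e]
proof (rule enum_mat_cong[OF e])
  fix x z assume z: "z \<in> carrier G"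
  have "(\<Sum>y\<in>carrier G. q x y * (if y = g \<otimes> z then 1 else 0)) =
      (\<Sum>y\<in>carrier G. if y = g \<otimes> z then q x y else 0)"
    by (intro sum.cong refl) simp
  then show "(\<Sum>y\<in>carrier G. q x y * (if y = g \<otimes> z then 1 else 0)) = q x (g \<otimes> z)"
    using z g finite_carrier by simp
qed

lemma regular_rep_is_rep:
  assumes e: "bij_betw e {..<card (carrier G)} (carrier G)"
  shows "is_rep G (card (carrier G)) (regular_rep e)"
  unfolding is_rep_def
proof (intro conjI ballI)
  show "regular_rep e g \<in> carrier_mat (card (carrier G)) (card (carrier G))" for g
    by (simp add: regular_rep_def)
  have "inj_on e {..<card (carrier G)}" using e by (rule bij_betw_imp_inj_on)
  then show "regular_rep e \<one> = 1\<^sub>m (card (carrier G))"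
    using bij_betw_apply[OF e]
    by (intro eq_matI) (auto simp: regular_rep_def enum_mat_def inj_on_def)
  show "regular_rep e (g \<otimes> h) = regular_rep e g * regular_rep e h"
    if g: "g \<in> carrier G" and h: "h \<in> carrier G" for g h
    unfolding regular_rep_def[of e h] regular_rep_mult_enum_mat[OF e g]
    unfolding regular_rep_def
  proof (rule enum_mat_cong[OF e])
    fix x z assume xz: "x \<in> carrier G" "z \<in> carrier G"
    have "x = g \<otimes> h \<otimes> z \<longleftrightarrow> inv g \<otimes> x = h \<otimes> z"
      using eq_mult_iff[of x "h \<otimes> z" g] g h xz by (auto simp: m_assoc)
    then show "(if x = g \<otimes> h \<otimes> z then 1 else 0) = (if inv g \<otimes> x = h \<otimes> z then 1 else (0 :: complex))" by simp
  qed
qed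

text \<open>Let $P$ be convolution by $f$ on the regular representation. It acts as $0$ on every
  irreducible subrepresentation, in particular on one inside the image of $P^*$; but $P P^* y = 0$
  forces $P^* y = 0$. So $P^* = 0$. Subrepresentations are encoded by injective matrices \<open>B\<close> whose columns
  span an invariant subspace, and irreducibility comes from minimality of the number of columns.\<close>

theorem class_function_eq_zero:
  assumes f: "\<And>g h. g \<in> carrier G \<Longrightarrow> h \<in> carrier G \<Longrightarrow> f (inv h \<otimes> g \<otimes> h) = f g"
    and orth: "\<And>\<chi>. \<chi> \<in> Irr G \<Longrightarrow> (\<Sum>g\<in>carrier G. f g * \<chi> g) = 0"
    and g0: "g0 \<in> carrier G"
  shows "f g0 = 0"
proof -
  define N where "N = card (carrier G)"
  obtain e where e': "bij_betw e {0..<card (carrier G)} (carrier G)"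
    using ex_bij_betw_nat_finite[OF finite_carrier] by blast
  then have e: "bij_betw e {..<card (carrier G)} (carrier G)" by (simp add: atLeast0LessThan)
  define U where "U = regular_rep e"
  have U: "is_rep G N U" unfolding U_def N_def by (rule regular_rep_is_rep[OF e])
  note Uc = rep_carrier[OF U]
  \<comment> \<open>Two descriptions of \<open>P\<close> are used: its entries give the adjoint
    \<open>Q\<close>, and the sum of \<open>f g\<close> times \<open>U g\<close> brings in
    \<open>class_sum_vanishes\<close>.\<close>
  define P where "P = enum_mat e (\<lambda>x y. f (x \<otimes> inv y))"
  have P: "P \<in> carrier_mat N N" by (simp add: P_def N_def)
  define Q where "Q = adjoint_mat P"
  have Q: "Q \<in> carrier_mat N N" using P by (simp add: Q_def)
  have Q_enum: "Q = enum_mat e (\<lambda>x y. cnj (f (y \<otimes> inv x)))"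
    unfolding Q_def P_def by (intro eq_matI) (auto simp: enum_mat_def adjoint_mat_def)
  have P_sum: "P = mat_sum N N (carrier G) (\<lambda>g. f g \<cdot>\<^sub>m U g)"
  proof (rule eq_matI)
    fix i j assume "i < dim_row (mat_sum N N (carrier G) (\<lambda>g. f g \<cdot>\<^sub>m U g))"
      "j < dim_col (mat_sum N N (carrier G) (\<lambda>g. f g \<cdot>\<^sub>m U g))"
    then have ij: "i < N" "j < N" by auto
    then have eij: "e i \<in> carrier G" "e j \<in> carrier G" using bij_betw_apply[OF e] by (auto simp: N_def)
    have "mat_sum N N (carrier G) (\<lambda>g. f g \<cdot>\<^sub>m U g) $$ (i, j) = (\<Sum>g\<in>carrier G. if g = e i \<otimes> inv (e j) then f g else 0)"
      using ij eij by (auto simp: U_def regular_rep_def enum_mat_def N_def inv_solve_right intro!: sum.cong)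
    also have "\<dots> = P $$ (i, j)" using ij eij finite_carrier by (simp add: P_def enum_mat_def N_def)
    finally show "P $$ (i, j) = mat_sum N N (carrier G) (\<lambda>g. f g \<cdot>\<^sub>m U g) $$ (i, j)" ..
  qed (auto simp: P_def enum_mat_def N_def)
  \<comment> \<open>\<open>Q\<close> commutes with translations because \<open>f\<close> is a class
    function, so its image is a subrepresentation.\<close>
  have UQ: "U g * Q = Q * U g" if g: "g \<in> carrier G" for g
    unfolding U_def Q_enum regular_rep_mult_enum_mat[OF e g] enum_mat_mult_regular_rep[OF e g]
  proof (rule enum_mat_cong[OF e])
    fix x y assume xy: "x \<in> carrier G" "y \<in> carrier G"
    have "f (inv g \<otimes> (g \<otimes> y \<otimes> inv x) \<otimes> g) = f (g \<otimes> y \<otimes> inv x)" by (rule f) (use g xy in auto)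
    moreover have "inv g \<otimes> (g \<otimes> y \<otimes> inv x) \<otimes> g = y \<otimes> inv (inv g \<otimes> x)"
      using g xy by (simp add: inv_mult_group m_assoc) (simp add: m_assoc[symmetric])
    ultimately show "cnj (f (y \<otimes> inv (inv g \<otimes> x))) = cnj (f (g \<otimes> y \<otimes> inv x))" by simp
  qed
  \<comment> \<open>The columns of \<open>B\<close> are a basis of a nonzero subrepresentation
    contained in the image of \<open>Q\<close>.\<close>
  define ok where "ok k B \<longleftrightarrow> B \<in> carrier_mat N k \<and> mat_inj k B \<and> k > 0 \<and>
    (\<forall>x\<in>carrier_vec k. \<exists>y\<in>carrier_vec N. B *\<^sub>v x = Q *\<^sub>v y) \<and>
    (\<forall>g\<in>carrier G. \<forall>x\<in>carrier_vec k. \<exists>y\<in>carrier_vec k. B *\<^sub>v y = U g *\<^sub>v (B *\<^sub>v x))" for k B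
  have no_ok: "\<not> (\<exists>k B. ok k B)"
  proof
    assume "\<exists>k B. ok k B"
    then obtain k where "\<exists>B. ok k B" and least: "\<And>j. j < k \<Longrightarrow> \<not> (\<exists>B. ok j B)"
      using exists_least_iff[of "\<lambda>k. \<exists>B. ok k B"] by blast
    then obtain B where "ok k B" by blast
    then have B: "B \<in> carrier_mat N k" "mat_inj k B" and k: "k > 0"
      and BQ: "\<And>x. x \<in> carrier_vec k \<Longrightarrow> \<exists>y\<in>carrier_vec N. B *\<^sub>v x = Q *\<^sub>v y"
      and BU: "\<And>g x. g \<in> carrier G \<Longrightarrow> x \<in> carrier_vec k \<Longrightarrow> \<exists>y\<in>carrier_vec k. B *\<^sub>v y = U g *\<^sub>v (B *\<^sub>v x)"
      by (auto simp: ok_def)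
    \<comment> \<open>Invariance of the column space compresses \<open>U g\<close> to a square
      matrix \<open>R g\<close> with B R(g) = U(g) B. That \<open>R\<close> is a representation
      follows because \<open>B\<close> can be cancelled on the left.\<close>
    have "\<exists>C\<in>carrier_mat k k. B * C = U g * B" if g: "g \<in> carrier G" for g
    proof (rule mat_factor_left[OF B(1)])
      show "U g * B \<in> carrier_mat N k" using Uc[OF g] B by simp
      show "\<exists>x\<in>carrier_vec k. B *\<^sub>v x = U g * B *\<^sub>v v" if v: "v \<in> carrier_vec k" for v
        using BU[OF g v] assoc_mult_mat_vec[OF Uc[OF g] B(1) v] by simp
    qed
    then obtain R where Rc: "\<And>g. g \<in> carrier G \<Longrightarrow> R g \<in> carrier_mat k k"
      and BR: "\<And>g. g \<in> carrier G \<Longrightarrow> B * R g = U g * B" by metis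
    have "is_rep G k R"
      unfolding is_rep_def
    proof (intro conjI ballI)
      show "R \<one> = 1\<^sub>m k"
        by (rule mat_inj_cancel[OF B(2,1) Rc]) (use BR[of \<one>] B in \<open>auto simp: rep_one[OF U]\<close>)
      fix g h assume g: "g \<in> carrier G" and h: "h \<in> carrier G"
      show "R (g \<otimes> h) = R g * R h"
      proof (rule mat_inj_cancel[OF B(2,1)])
        have "B * R (g \<otimes> h) = U g * U h * B" using BR[of "g \<otimes> h"] g h by (simp add: rep_mult[OF U])
        also have "\<dots> = U g * (U h * B)" by (rule assoc_mult_mat[OF Uc[OF g] Uc[OF h] B(1)])
        also have "\<dots> = U g * B * R h"
          unfolding BR[OF h, symmetric] by (rule assoc_mult_mat[OF Uc[OF g] B(1) Rc[OF h], symmetric])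
        also have "\<dots> = B * (R g * R h)"
          unfolding BR[OF g, symmetric] by (rule assoc_mult_mat[OF B(1) Rc[OF g] Rc[OF h]])
        finally show "B * R (g \<otimes> h) = B * (R g * R h)" .
      qed (use Rc g h in \<open>auto intro!: mult_carrier_mat\<close>)
    qed (use Rc in auto)
    \<comment> \<open>A basis matrix \<open>C\<close> of \<open>W\<close> gives the
      subrepresentation with basis matrix \<open>B * C\<close>; minimality of \<open>k\<close>
      leaves only the dimensions 0 and \<open>k\<close>.\<close>
    moreover have "W = {0\<^sub>v k} \<or> W = carrier_vec k" if W: "invariant_subspace G k R W" for W
    proof -
      have "W \<subseteq> carrier_vec k" "0\<^sub>v k \<in> W" "\<And>v w. v \<in> W \<Longrightarrow> w \<in> W \<Longrightarrow> v + w \<in> W" "\<And>c w. w \<in> W \<Longrightarrow> c \<cdot>\<^sub>v w \<in> W"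
        using W by (auto simp: invariant_subspace_def)
      then obtain j C where C: "C \<in> carrier_mat k j" "mat_inj j C" "W = (\<lambda>x. C *\<^sub>v x) ` carrier_vec j"
        "j \<le> k" "j = k \<Longrightarrow> W = carrier_vec k" using subspace_basis_mat[of W k] by metis
      have ass: "(B * C) *\<^sub>v x = B *\<^sub>v (C *\<^sub>v x)" if "x \<in> carrier_vec j" for x
        by (rule assoc_mult_mat_vec[OF B(1) C(1) that])
      have "ok j (B * C)" if "j > 0"
        unfolding ok_def
      proof (intro conjI ballI)
        show "B * C \<in> carrier_mat N j" using B C by simp
        show "mat_inj j (B * C)" by (rule mat_inj_mult[OF B(2,1) C(2,1)])
        fix x :: "complex vec" assume x: "x \<in> carrier_vec j"
        have Cx: "C *\<^sub>v x \<in> carrier_vec k" using C x by simp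
        show "\<exists>y\<in>carrier_vec N. B * C *\<^sub>v x = Q *\<^sub>v y" unfolding ass[OF x] by (rule BQ[OF Cx])
        fix g assume g: "g \<in> carrier G"
        have "R g *\<^sub>v (C *\<^sub>v x) \<in> W" using W g x C(3) by (auto simp: invariant_subspace_def)
        then obtain y where y: "y \<in> carrier_vec j" "R g *\<^sub>v (C *\<^sub>v x) = C *\<^sub>v y" using C(3) by auto
        have "B * C *\<^sub>v y = B *\<^sub>v (R g *\<^sub>v (C *\<^sub>v x))" unfolding ass[OF y(1)] y(2) ..
        also have "\<dots> = B * R g *\<^sub>v (C *\<^sub>v x)" by (rule assoc_mult_mat_vec[OF B(1) Rc[OF g] Cx, symmetric])
        also have "\<dots> = U g *\<^sub>v (B * C *\<^sub>v x)"
          unfolding BR[OF g] ass[OF x] by (rule assoc_mult_mat_vec[OF Uc[OF g] B(1) Cx])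
        finally show "\<exists>y\<in>carrier_vec j. B * C *\<^sub>v y = U g *\<^sub>v (B * C *\<^sub>v x)" using y(1) by blast
      qed (use that in auto)
      then consider "j = 0" | "j = k" using least[of j] C(4) by fastforce
      then show ?thesis
      proof cases
        case 1
        have "C *\<^sub>v x = 0\<^sub>v k" if "x \<in> carrier_vec j" for x
        proof -
          have "x = 0\<^sub>v j" using that 1 by (intro eq_vecI) auto
          then show ?thesis using mult_mat_zero_vec[OF C(1)] by simp
        qed
        moreover have "carrier_vec j \<noteq> ({} :: complex vec set)" using zero_carrier_vec by blast
        ultimately have "W = {0\<^sub>v k}" unfolding C(3) by (simp add: image_constant_conv cong: image_cong)
        then show ?thesis ..
      qed (use C(5) in auto)
    qed
    ultimately have R: "irreducible_rep G k R" using k by (auto simp: irreducible_rep_def)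
    have "P * B = mat_sum N k (carrier G) (\<lambda>g. f g \<cdot>\<^sub>m U g * B)"
      unfolding P_sum by (rule mat_sum_mult[OF B(1)]) (use Uc in auto)
    also have "\<dots> = mat_sum N k (carrier G) (\<lambda>g. B * (f g \<cdot>\<^sub>m R g))"
    proof (rule mat_sum_cong[OF refl])
      fix g assume g: "g \<in> carrier G"
      have "f g \<cdot>\<^sub>m U g * B = f g \<cdot>\<^sub>m (U g * B)" by (rule mult_smult_assoc_mat[OF Uc[OF g] B(1)])
      also have "\<dots> = B * (f g \<cdot>\<^sub>m R g)"
        unfolding BR[OF g, symmetric] by (rule mult_smult_distrib[OF B(1) Rc[OF g], symmetric])
      finally show "f g \<cdot>\<^sub>m U g * B = B * (f g \<cdot>\<^sub>m R g)" .
    qed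
    also have "\<dots> = B * mat_sum k k (carrier G) (\<lambda>g. f g \<cdot>\<^sub>m R g)"
      by (rule mult_mat_sum[OF B(1), symmetric]) (use Rc in auto)
    also have "mat_sum k k (carrier G) (\<lambda>g. f g \<cdot>\<^sub>m R g) = 0\<^sub>m k k"
      by (rule class_sum_vanishes[OF f orth R])
    also have "B * 0\<^sub>m k k = 0\<^sub>m N k" using B(1) by simp
    finally have PB: "P * B = 0\<^sub>m N k" .
    \<comment> \<open>The first column of \<open>B\<close> is some Q y with P Q y = 0, hence it is
      zero, against independence of the columns.\<close>
    obtain y where y: "y \<in> carrier_vec N" "B *\<^sub>v unit_vec k 0 = Q *\<^sub>v y" using BQ[of "unit_vec k 0"] by auto
    have "P *\<^sub>v (Q *\<^sub>v y) = P * B *\<^sub>v unit_vec k 0"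
      unfolding y(2)[symmetric] by (rule assoc_mult_mat_vec[OF P B(1), symmetric]) simp
    also have "\<dots> = 0\<^sub>v N" unfolding PB by (rule zero_mat_mult_vec) simp
    finally have "Q *\<^sub>v y = 0\<^sub>v N" unfolding Q_def by (rule adjoint_mat_mult_vec_eq_zero[OF P y(1)])
    then have "unit_vec k 0 = (0\<^sub>v k :: complex vec)"
      using mat_injD[OF B(2,1), of "unit_vec k 0"] y(2) by simp
    then show False using unit_vec_nonzero[OF k] by metis
  qed
  define W where "W = (\<lambda>x. Q *\<^sub>v x) ` carrier_vec N"
  have sub: "W \<subseteq> carrier_vec N" "0\<^sub>v N \<in> W"
    using Q mult_mat_zero_vec[OF Q] unfolding W_def by (auto intro!: image_eqI[of _ _ "0\<^sub>v N"])
  have add: "v + w \<in> W" if vw: "v \<in> W" "w \<in> W" for v w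
  proof -
    obtain x y where xy: "x \<in> carrier_vec N" "y \<in> carrier_vec N" "v = Q *\<^sub>v x" "w = Q *\<^sub>v y"
      using vw unfolding W_def by blast
    show ?thesis unfolding xy(3,4) mult_add_distrib_mat_vec[OF Q xy(1,2), symmetric] W_def
      by (intro imageI) (use xy in auto)
  qed
  have smult: "c \<cdot>\<^sub>v w \<in> W" if w: "w \<in> W" for c w
  proof -
    obtain x where x: "x \<in> carrier_vec N" "w = Q *\<^sub>v x" using w unfolding W_def by blast
    show ?thesis unfolding x(2) mult_mat_vec[OF Q x(1), symmetric] W_def
      by (intro imageI) (use x in auto)
  qed
  obtain k B where B: "B \<in> carrier_mat N k" "mat_inj k B" "W = (\<lambda>x. B *\<^sub>v x) ` carrier_vec k"
    using subspace_basis_mat[OF sub add smult] by metis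
  \<comment> \<open>A basis of the whole image of \<open>Q\<close> would qualify, unless that image
    is zero.\<close>
  have "ok k B" if "k > 0"
    unfolding ok_def
  proof (intro conjI ballI)
    fix x :: "complex vec" assume x: "x \<in> carrier_vec k"
    then have "B *\<^sub>v x \<in> W" using B(3) by auto
    then obtain y where y: "y \<in> carrier_vec N" "B *\<^sub>v x = Q *\<^sub>v y" by (auto simp: W_def)
    then show "\<exists>y\<in>carrier_vec N. B *\<^sub>v x = Q *\<^sub>v y" by blast
    fix g assume g: "g \<in> carrier G"
    have "U g *\<^sub>v (B *\<^sub>v x) = U g * Q *\<^sub>v y"
      unfolding y(2) by (rule assoc_mult_mat_vec[OF Uc[OF g] Q y(1), symmetric])
    also have "\<dots> = Q *\<^sub>v (U g *\<^sub>v y)"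
      unfolding UQ[OF g] by (rule assoc_mult_mat_vec[OF Q Uc[OF g] y(1)])
    finally have "U g *\<^sub>v (B *\<^sub>v x) \<in> W"
      unfolding W_def using Uc[OF g] y(1) by auto
    then show "\<exists>y\<in>carrier_vec k. B *\<^sub>v y = U g *\<^sub>v (B *\<^sub>v x)" using B(3) by auto
  qed (use B that in auto)
  then have "k = 0" using no_ok by auto
  have "Q = 0\<^sub>m N N"
  proof (rule mat_vec_ext[OF Q])
    fix v :: "complex vec" assume v: "v \<in> carrier_vec N"
    then have "Q *\<^sub>v v \<in> W" by (auto simp: W_def)
    then obtain x where x: "x \<in> carrier_vec k" "Q *\<^sub>v v = B *\<^sub>v x" using B(3) by auto
    then have "x = 0\<^sub>v k" using \<open>k = 0\<close> by (intro eq_vecI) auto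
    then show "Q *\<^sub>v v = 0\<^sub>m N N *\<^sub>v v" using x mult_mat_zero_vec[OF B(1)] zero_mat_mult_vec[OF v] by simp
  qed auto
  have "carrier G = e ` {..<N}" using bij_betw_imp_surj_on[OF e] by (simp add: N_def)
  then have "g0 \<in> e ` {..<N}" "\<one> \<in> e ` {..<N}" using g0 one_closed by simp_all
  then obtain i j where ij: "i < N" "j < N" "e i = g0" "e j = \<one>" by (auto simp: image_iff)
  \<comment> \<open>The row of \<open>\<one>\<close> and the column of \<open>g0\<close> meet in the
    conjugate of \<open>f g0\<close>.\<close>
  have "Q $$ (j, i) = 0" unfolding \<open>Q = 0\<^sub>m N N\<close> using ij by simp
  then show ?thesis using ij g0 by (simp add: Q_enum enum_mat_def N_def)
qed

section \<open>Conjugacy classes and column orthogonality\<close>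

lemma conj_class_subset: "x \<in> carrier G \<Longrightarrow> conj_class G x \<subseteq> carrier G"
  by (auto simp: conj_class_def)

lemma conj_class_self: "x \<in> carrier G \<Longrightarrow> x \<in> conj_class G x"
  unfolding conj_class_def by (auto intro!: exI[of _ \<one>])

text \<open>Makes the indicator of a class a class function, so that completeness can be applied to
  it.\<close>

lemma conj_class_conj_iff:
  assumes x: "x \<in> carrier G" and g: "g \<in> carrier G" and h: "h \<in> carrier G"
  shows "inv h \<otimes> g \<otimes> h \<in> conj_class G x \<longleftrightarrow> g \<in> conj_class G x"
proof
  assume "g \<in> conj_class G x"
  then obtain k where k: "k \<in> carrier G" "g = inv k \<otimes> x \<otimes> k" by (auto simp: conj_class_def)
  then have "inv h \<otimes> g \<otimes> h = inv (k \<otimes> h) \<otimes> x \<otimes> (k \<otimes> h)" using x h by (simp add: inv_mult_group m_assoc)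
  then show "inv h \<otimes> g \<otimes> h \<in> conj_class G x" using k h by (auto simp: conj_class_def)
next
  assume "inv h \<otimes> g \<otimes> h \<in> conj_class G x"
  then obtain k where k: "k \<in> carrier G" "inv h \<otimes> g \<otimes> h = inv k \<otimes> x \<otimes> k" by (auto simp: conj_class_def)
  have "g = h \<otimes> (inv h \<otimes> g \<otimes> h) \<otimes> inv h"
    using g h by (simp add: m_assoc) (simp add: m_assoc[symmetric])
  also have "\<dots> = inv (k \<otimes> inv h) \<otimes> x \<otimes> (k \<otimes> inv h)"
    unfolding k(2) using x h k(1) by (simp add: inv_mult_group m_assoc)
  finally show "g \<in> conj_class G x" using k(1) h by (auto simp: conj_class_def)
qed

lemma Irr_const_on_class: "\<chi> \<in> Irr G \<Longrightarrow> x \<in> carrier G \<Longrightarrow> y \<in> conj_class G x \<Longrightarrow> \<chi> y = \<chi> x"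
  by (auto simp: conj_class_def Irr_conj)

text \<open>Frees evaluation from the representative picked by \<open>SOME\<close>, since characters
  are constant on classes.\<close>

lemma eval_class_eq:
  assumes \<chi>: "\<chi> \<in> Irr G" and C: "C \<in> conj_classes G" and x: "x \<in> C"
  shows "eval_class \<chi> C = \<chi> x"
proof -
  obtain y where y: "y \<in> carrier G" "C = conj_class G y" using C by (auto simp: conj_classes_def)
  have "(SOME x. x \<in> C) \<in> C" using x by (rule someI)
  then show ?thesis using Irr_const_on_class[OF \<chi> y(1)] x y(2) by (simp add: eval_class_def)
qed

text \<open>The indicator of the class of \<open>g\<close> equals its expansion in conjugate
  characters, because the difference is a class function orthogonal to every character. Evaluating
  the expansion at \<open>h\<close> gives the formula.\<close>

theorem Irr_column_orthogonality:
  assumes g: "g \<in> carrier G" and h: "h \<in> carrier G"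
  shows "(\<Sum>\<chi>\<in>Irr G. \<chi> g * cnj (\<chi> h)) =
    (if h \<in> conj_class G g then of_nat (card (carrier G)) / of_nat (card (conj_class G g)) else 0)"
proof -
  let ?C = "conj_class G g" and ?n = "of_nat (card (carrier G)) :: complex"
  have finC: "finite ?C" using conj_class_subset[OF g] finite_carrier by (rule finite_subset)
  have n: "?n \<noteq> 0" using card_carrier_pos by simp
  have C: "of_nat (card ?C) \<noteq> (0 :: complex)" using finC conj_class_self[OF g] by auto
  \<comment> \<open>The coefficient is the normalized pairing of the indicator with \<chi>.
    Conjugates appear in the expansion because the orthogonality condition in
    \<open>class_function_eq_zero\<close> pairs without conjugation.\<close>
  define f where "f k = (if k \<in> ?C then 1 else 0) - (\<Sum>\<chi>\<in>Irr G. of_nat (card ?C) * \<chi> g / ?n * cnj (\<chi> k))" for k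
  have "f h = 0"
  proof (rule class_function_eq_zero[OF _ _ h])
    show "f (inv k \<otimes> x \<otimes> k) = f x" if "x \<in> carrier G" "k \<in> carrier G" for x k
      unfolding f_def using that by (simp add: conj_class_conj_iff[OF g] Irr_conj cong: sum.cong)
    fix \<psi> assume \<psi>: "\<psi> \<in> Irr G"
    have "(\<Sum>k\<in>carrier G. f k * \<psi> k) = (\<Sum>k\<in>carrier G. if k \<in> ?C then \<psi> k else 0) -
        (\<Sum>k\<in>carrier G. \<Sum>\<chi>\<in>Irr G. of_nat (card ?C) * \<chi> g / ?n * (\<psi> k * cnj (\<chi> k)))"
      unfolding f_def sum_subtractf[symmetric]
      by (intro sum.cong refl) (simp add: left_diff_distrib right_diff_distrib sum_distrib_left sum_distrib_right mult_ac)
    also have "(\<Sum>k\<in>carrier G. if k \<in> ?C then \<psi> k else 0) = (\<Sum>k\<in>?C. \<psi> k)"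
      using conj_class_subset[OF g] finite_carrier by (simp add: sum.inter_restrict[symmetric] Int_absorb1)
    also have "\<dots> = of_nat (card ?C) * \<psi> g"
      using Irr_const_on_class[OF \<psi> g] by simp
    also have "(\<Sum>k\<in>carrier G. \<Sum>\<chi>\<in>Irr G. of_nat (card ?C) * \<chi> g / ?n * (\<psi> k * cnj (\<chi> k))) =
        (\<Sum>\<chi>\<in>Irr G. of_nat (card ?C) * \<chi> g / ?n * (\<Sum>k\<in>carrier G. \<psi> k * cnj (\<chi> k)))"
      unfolding sum_distrib_left by (rule sum.swap)
    also have "\<dots> = (\<Sum>\<chi>\<in>Irr G. if \<psi> = \<chi> then of_nat (card ?C) * \<chi> g else 0)"
      using n by (intro sum.cong refl) (simp add: Irr_orthonormal[OF \<psi>])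
    also have "\<dots> = of_nat (card ?C) * \<psi> g" using \<psi> finite_Irr by simp
    finally show "(\<Sum>k\<in>carrier G. f k * \<psi> k) = 0" by simp
  qed
  then have "(if h \<in> ?C then 1 else 0) = of_nat (card ?C) / ?n * (\<Sum>\<chi>\<in>Irr G. \<chi> g * cnj (\<chi> h))"
    unfolding f_def by (simp add: sum_distrib_left sum_divide_distrib mult_ac)
  then show ?thesis using n C by (simp add: field_simps split: if_splits)
qed

end

section \<open>Primitive characters of products\<close>

text \<open>Symmetry and transitivity of conjugacy; it makes distinct classes disjoint, as
  \<open>Irr_kernel\<close> requires.\<close>

lemma (in fin_group) conj_class_eq:
  assumes C: "C \<in> conj_classes G" and y: "y \<in> C"
  shows "conj_class G y = C"
proof -
  obtain x where x: "x \<in> carrier G" "C = conj_class G x" using C by (auto simp: conj_classes_def)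
  obtain k where k: "k \<in> carrier G" "y = inv k \<otimes> x \<otimes> k" using y x(2) by (auto simp: conj_class_def)
  have yc: "y \<in> carrier G" using k x by simp
  have "z \<in> conj_class G x" if "z \<in> conj_class G y" for z
    using that y x yc by (auto simp: conj_class_def[of G y] conj_class_conj_iff)
  moreover have "z \<in> conj_class G y" if z: "z \<in> conj_class G x" for z
  proof -
    have "x = inv (inv k) \<otimes> y \<otimes> inv k"
      using k(1) x(1) unfolding k(2) by (simp add: m_assoc) (simp add: m_assoc[symmetric])
    then have "x \<in> conj_class G y" using k(1) unfolding conj_class_def by blast
    then show ?thesis using z x(1) by (auto simp: conj_class_def[of G x] conj_class_conj_iff[OF yc])
  qed
  ultimately show ?thesis using x(2) by blast
qed

section \<open>Product groups and inflation of characters\<close>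

locale group_family =
  fixes G :: "'l \<Rightarrow> ('g, 'b) monoid_scheme" and \<Lambda> :: "'l set"
  assumes finite_index: "finite \<Lambda>" and fin_group: "\<And>l. l \<in> \<Lambda> \<Longrightarrow> fin_group (G l)"
begin

lemma finite_sub: "D \<subseteq> \<Lambda> \<Longrightarrow> finite D"
  using finite_index finite_subset by blast

lemma group_fam: "l \<in> \<Lambda> \<Longrightarrow> group (G l)"
  using fin_group fin_group.axioms(1) by blast

lemma carrier_G_prod [simp]: "carrier (G_prod G D) = (\<Pi>\<^sub>E l\<in>D. carrier (G l))"
  by (simp add: G_prod_def)

lemma one_G_prod [simp]: "\<one>\<^bsub>G_prod G D\<^esub> = (\<lambda>l\<in>D. \<one>\<^bsub>G l\<^esub>)"
  by (simp add: G_prod_def)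

lemma mult_G_prod [simp]: "x \<otimes>\<^bsub>G_prod G D\<^esub> y = (\<lambda>l\<in>D. x l \<otimes>\<^bsub>G l\<^esub> y l)"
  by (simp add: G_prod_def)

lemma fin_group_G_prod:
  assumes "D \<subseteq> \<Lambda>"
  shows "fin_group (G_prod G D)"
proof -
  have "group (G_prod G D)"
    unfolding G_prod_def using assms group_fam by (intro product_group) auto
  moreover have "finite (carrier (G_prod G D))"
    using assms fin_group finite_sub by (auto intro!: finite_PiE simp: fin_group.finite_carrier subset_iff)
  ultimately show ?thesis by (simp add: fin_group_def fin_group_axioms_def)
qed

lemma inv_G_prod:
  "D \<subseteq> \<Lambda> \<Longrightarrow> x \<in> (\<Pi>\<^sub>E l\<in>D. carrier (G l)) \<Longrightarrow> inv\<^bsub>G_prod G D\<^esub> x = (\<lambda>l\<in>D. inv\<^bsub>G l\<^esub> x l)"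
  unfolding G_prod_def using group_fam by (intro inv_product_group) auto

text \<open>Conjugators can be chosen independently in each coordinate. This is why
  \<open>rho_D\<close>, defined as a product set, is a conjugacy class of the product group.\<close>

lemma conj_class_G_prod:
  assumes D: "D \<subseteq> \<Lambda>" and x: "x \<in> (\<Pi>\<^sub>E l\<in>D. carrier (G l))"
  shows "conj_class (G_prod G D) x = (\<Pi>\<^sub>E l\<in>D. conj_class (G l) (x l))"
proof (intro subset_antisym subsetI)
  fix y assume "y \<in> conj_class (G_prod G D) x"
  then obtain g where g: "g \<in> (\<Pi>\<^sub>E l\<in>D. carrier (G l))"
    "y = inv\<^bsub>G_prod G D\<^esub> g \<otimes>\<^bsub>G_prod G D\<^esub> x \<otimes>\<^bsub>G_prod G D\<^esub> g"
    by (auto simp: conj_class_def)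
  then have "y = (\<lambda>l\<in>D. inv\<^bsub>G l\<^esub> g l \<otimes>\<^bsub>G l\<^esub> x l \<otimes>\<^bsub>G l\<^esub> g l)"
    using inv_G_prod[OF D g(1)] by (auto simp: fun_eq_iff)
  then show "y \<in> (\<Pi>\<^sub>E l\<in>D. conj_class (G l) (x l))"
    using g(1) by (auto simp: conj_class_def)
next
  fix y assume y: "y \<in> (\<Pi>\<^sub>E l\<in>D. conj_class (G l) (x l))"
  then have "\<forall>l\<in>D. \<exists>g. g \<in> carrier (G l) \<and> y l = inv\<^bsub>G l\<^esub> g \<otimes>\<^bsub>G l\<^esub> x l \<otimes>\<^bsub>G l\<^esub> g"
    by (fastforce simp: conj_class_def PiE_iff)
  then obtain g where g: "\<And>l. l \<in> D \<Longrightarrow> g l \<in> carrier (G l)"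
    "\<And>l. l \<in> D \<Longrightarrow> y l = inv\<^bsub>G l\<^esub> g l \<otimes>\<^bsub>G l\<^esub> x l \<otimes>\<^bsub>G l\<^esub> g l" by metis
  define g' where "g' = restrict g D"
  have g': "g' \<in> (\<Pi>\<^sub>E l\<in>D. carrier (G l))" using g(1) by (auto simp: g'_def)
  have "y = inv\<^bsub>G_prod G D\<^esub> g' \<otimes>\<^bsub>G_prod G D\<^esub> x \<otimes>\<^bsub>G_prod G D\<^esub> g'"
    unfolding inv_G_prod[OF D g'] using y g(2) by (auto simp: fun_eq_iff g'_def PiE_iff extensional_def)
  then show "y \<in> conj_class (G_prod G D) x" using g' by (auto simp: conj_class_def)
qed

text \<open>For \<open>E \<subseteq> D\<close>, a section of the projection onto the coordinates in
  \<open>E\<close>; it supplies the preimages showing that the projection is onto.\<close>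

definition extend_one :: "'l set \<Rightarrow> 'l set \<Rightarrow> ('l \<Rightarrow> 'g) \<Rightarrow> 'l \<Rightarrow> 'g" where
  "extend_one D E f = (\<lambda>l\<in>D. if l \<in> E then f l else \<one>\<^bsub>G l\<^esub>)"

lemma extend_one_carrier:
  "D \<subseteq> \<Lambda> \<Longrightarrow> f \<in> (\<Pi>\<^sub>E l\<in>E. carrier (G l)) \<Longrightarrow> extend_one D E f \<in> (\<Pi>\<^sub>E l\<in>D. carrier (G l))"
  using group_fam by (auto simp: extend_one_def PiE_iff group.is_monoid)

lemma restrict_extend_one:
  "E \<subseteq> D \<Longrightarrow> f \<in> (\<Pi>\<^sub>E l\<in>E. carrier (G l)) \<Longrightarrow> restrict (extend_one D E f) E = f"
  by (auto simp: extend_one_def fun_eq_iff PiE_iff extensional_def)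

lemma restrict_carrier:
  "E \<subseteq> D \<Longrightarrow> f \<in> (\<Pi>\<^sub>E l\<in>D. carrier (G l)) \<Longrightarrow> restrict f E \<in> (\<Pi>\<^sub>E l\<in>E. carrier (G l))"
  by auto

lemma inflate_apply: "f \<in> (\<Pi>\<^sub>E l\<in>D. carrier (G l)) \<Longrightarrow> inflate G D E \<psi> f = \<psi> (restrict f E)"
  by (simp add: inflate_def)

lemma inflate_extend_one:
  "D \<subseteq> \<Lambda> \<Longrightarrow> E \<subseteq> D \<Longrightarrow> f \<in> (\<Pi>\<^sub>E l\<in>E. carrier (G l)) \<Longrightarrow> inflate G D E \<psi> (extend_one D E f) = \<psi> f"
  by (simp add: inflate_apply extend_one_carrier restrict_extend_one)

text \<open>The projection is onto, so a subspace invariant under the inflated representation is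
  invariant under the original one.\<close>

lemma inflate_Irr:
  assumes D: "D \<subseteq> \<Lambda>" and E: "E \<subseteq> D" and \<psi>: "\<psi> \<in> Irr (G_prod G E)"
  shows "inflate G D E \<psi> \<in> Irr (G_prod G D)"
proof -
  interpret GE: fin_group "G_prod G E" using fin_group_G_prod D E by simp
  obtain n R where R: "irreducible_rep (G_prod G E) n R"
    and \<psi>_eq: "\<psi> = (\<lambda>g\<in>carrier (G_prod G E). mat_trace (R g))" using \<psi> by (rule GE.IrrE)
  define R' where "R' f = R (restrict f E)" for f
  have res: "restrict f E \<in> carrier (G_prod G E)" if "f \<in> carrier (G_prod G D)" for f
    using restrict_carrier[OF E] that by simp
  have "is_rep (G_prod G D) n R'"
    unfolding is_rep_def
  proof (intro conjI ballI)
    show "R' g \<in> carrier_mat n n" if "g \<in> carrier (G_prod G D)" for g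
      unfolding R'_def using GE.rep_carrier[OF GE.irreducible_is_rep[OF R] res[OF that]] .
    have "restrict \<one>\<^bsub>G_prod G D\<^esub> E = \<one>\<^bsub>G_prod G E\<^esub>" using E by (auto simp: fun_eq_iff)
    then show "R' \<one>\<^bsub>G_prod G D\<^esub> = 1\<^sub>m n"
      unfolding R'_def using GE.rep_one[OF GE.irreducible_is_rep[OF R]] by simp
    fix g h assume gh: "g \<in> carrier (G_prod G D)" "h \<in> carrier (G_prod G D)"
    have "restrict (g \<otimes>\<^bsub>G_prod G D\<^esub> h) E = restrict g E \<otimes>\<^bsub>G_prod G E\<^esub> restrict h E"
      using E by (auto simp: fun_eq_iff)
    then show "R' (g \<otimes>\<^bsub>G_prod G D\<^esub> h) = R' g * R' h"
      unfolding R'_def using GE.rep_mult[OF GE.irreducible_is_rep[OF R] res[OF gh(1)] res[OF gh(2)]] by simp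
  qed
  moreover have "invariant_subspace (G_prod G E) n R W" if W: "invariant_subspace (G_prod G D) n R' W" for W
  proof -
    have "R g *\<^sub>v w \<in> W" if g: "g \<in> carrier (G_prod G E)" and w: "w \<in> W" for g w
    proof -
      have "extend_one D E g \<in> carrier (G_prod G D)" using extend_one_carrier[OF D] g by simp
      then have "R' (extend_one D E g) *\<^sub>v w \<in> W" using W w unfolding invariant_subspace_def by blast
      then show ?thesis using restrict_extend_one[OF E] g by (simp add: R'_def)
    qed
    then show ?thesis using W unfolding invariant_subspace_def by blast
  qed
  ultimately have "irreducible_rep (G_prod G D) n R'"
    using R unfolding irreducible_rep_def by blast
  moreover have "inflate G D E \<psi> = (\<lambda>g\<in>carrier (G_prod G D). mat_trace (R' g))"
    unfolding inflate_def \<psi>_eq R'_def using res by (auto simp: fun_eq_iff)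
  ultimately show ?thesis unfolding Irr_def by blast
qed

lemma inflate_inj:
  assumes D: "D \<subseteq> \<Lambda>" and E: "E \<subseteq> D" and "\<psi> \<in> Irr (G_prod G E)" "\<phi> \<in> Irr (G_prod G E)"
    and eq: "inflate G D E \<psi> = inflate G D E \<phi>"
  shows "\<psi> = \<phi>"
proof -
  interpret GE: fin_group "G_prod G E" using fin_group_G_prod D E by simp
  show ?thesis
  proof (rule GE.Irr_ext)
    fix g assume "g \<in> carrier (G_prod G E)"
    then have "g \<in> (\<Pi>\<^sub>E l\<in>E. carrier (G l))" by simp
    then show "\<psi> g = \<phi> g" using inflate_extend_one[OF D E] eq by metis
  qed fact+
qed

lemma inflate_inflate:
  assumes "F \<subseteq> E" "E \<subseteq> D"
  shows "inflate G D E (inflate G E F \<psi>) = inflate G D F \<psi>"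
  using assms restrict_carrier[OF assms(2)]
  by (auto simp: inflate_def fun_eq_iff Int_absorb1 Int_absorb2)

lemma inflate_self:
  assumes "D \<subseteq> \<Lambda>" "\<chi> \<in> Irr (G_prod G D)"
  shows "inflate G D D \<chi> = \<chi>"
proof -
  interpret GD: fin_group "G_prod G D" using fin_group_G_prod assms by simp
  show ?thesis
    by (rule GD.Irr_ext) (use assms inflate_Irr in \<open>auto simp: inflate_apply PiE_restrict\<close>)
qed

section \<open>Decomposition of characters by their primitive origin\<close>

text \<open>Descent along proper subsets: an imprimitive character comes from a smaller set, and
  inflations compose.\<close>

lemma Irr_from_Prim:
  assumes "D \<subseteq> \<Lambda>" "\<chi> \<in> Irr (G_prod G D)"
  shows "\<exists>E\<subseteq>D. \<exists>\<psi>\<in>Prim G E. \<chi> = inflate G D E \<psi>"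
  using finite_sub[OF assms(1)] assms
proof (induction D arbitrary: \<chi> rule: finite_psubset_induct)
  case (psubset D)
  show ?case
  proof (cases "\<chi> \<in> Prim G D")
    case True
    then show ?thesis using inflate_self[OF psubset.prems] by (intro exI[of _ D] conjI bexI[of _ \<chi>]) auto
  next
    case False
    then obtain E \<psi> where E: "E \<subset> D" "\<psi> \<in> Irr (G_prod G E)" "\<chi> = inflate G D E \<psi>"
      using psubset.prems by (auto simp: Prim_def)
    have "E \<subseteq> \<Lambda>" using E(1) psubset.prems(1) by blast
    from psubset.IH[OF E(1) this E(2)] obtain F \<phi>
      where "F \<subseteq> E" "\<phi> \<in> Prim G F" "\<psi> = inflate G E F \<phi>" by blast
    then show ?thesis using E(1,3) inflate_inflate[of F E D] by (intro exI[of _ F]) auto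
  qed
qed

text \<open>The character \<open>\<psi>1\<close> is constant on the kernel of the projection to $G_{E_1 \cap E_2}$. If it were
  orthogonal to every inflated character, pairing it with the inflated regular character of
  $G_{E_1 \cap E_2}$, which is supported on that kernel, would give \<open>\<psi>1(1) = 0\<close>.\<close>

lemma inflate_eq_imp_inter:
  assumes D: "D \<subseteq> \<Lambda>" and E: "E1 \<subseteq> D" "E2 \<subseteq> D"
    and \<psi>: "\<psi>1 \<in> Irr (G_prod G E1)"
    and eq: "inflate G D E1 \<psi>1 = inflate G D E2 \<psi>2"
  shows "\<exists>\<phi>\<in>Irr (G_prod G (E1 \<inter> E2)). \<psi>1 = inflate G E1 (E1 \<inter> E2) \<phi>"
proof (rule ccontr)
  let ?F = "E1 \<inter> E2"
  assume contra: "\<not> ?thesis"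
  have sub: "E1 \<subseteq> \<Lambda>" "?F \<subseteq> \<Lambda>" "?F \<subseteq> E1" using D E by auto
  interpret G1: fin_group "G_prod G E1" by (rule fin_group_G_prod[OF sub(1)])
  interpret GF: fin_group "G_prod G ?F" by (rule fin_group_G_prod[OF sub(2)])
  have ker: "\<psi>1 f = \<psi>1 \<one>\<^bsub>G_prod G E1\<^esub>"
    if f: "f \<in> carrier (G_prod G E1)" and f1: "restrict f ?F = \<one>\<^bsub>G_prod G ?F\<^esub>" for f
  proof -
    \<comment> \<open>Through the common inflation, \<psi>1 is computed by \<psi>2 on the
      coordinates in \<open>E2\<close>. An element that is trivial on \<open>?F\<close> and filled
      up with identities outside \<open>E1\<close> cannot be told from the identity there.\<close>
    have val: "\<psi>1 g = \<psi>2 (restrict (extend_one D E1 g) E2)" if "g \<in> carrier (G_prod G E1)" for g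
      using inflate_extend_one[OF D E(1), of g \<psi>1] extend_one_carrier[OF D, of g E1] that eq
      by (simp add: inflate_apply)
    have "f l = \<one>\<^bsub>G l\<^esub>" if "l \<in> E1" "l \<in> E2" for l
      using fun_cong[OF f1, of l] that by simp
    then have "restrict (extend_one D E1 f) E2 = restrict (extend_one D E1 \<one>\<^bsub>G_prod G E1\<^esub>) E2"
      using E by (auto simp: extend_one_def fun_eq_iff)
    then show ?thesis using val[OF f] val[OF G1.one_closed] by simp
  qed
  have classone: "conj_class (G_prod G ?F) \<one>\<^bsub>G_prod G ?F\<^esub> = {\<one>\<^bsub>G_prod G ?F\<^esub>}"
    unfolding conj_class_def using GF.one_closed by (force simp del: one_G_prod mult_G_prod carrier_G_prod)
  let ?c = "complex_of_nat (card (carrier (G_prod G ?F)))"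
  \<comment> \<open>The conjugate of the regular character of the intersection, pulled back to
    \<open>E1\<close>; column orthogonality at the identity, whose class is a singleton, evaluates
    it.\<close>
  let ?s = "\<lambda>f. \<Sum>\<phi>\<in>Irr (G_prod G ?F). \<phi> \<one>\<^bsub>G_prod G ?F\<^esub> * cnj (\<phi> (restrict f ?F))"
  have s: "?s f = (if restrict f ?F = \<one>\<^bsub>G_prod G ?F\<^esub> then ?c else 0)"
    if "f \<in> carrier (G_prod G E1)" for f
  proof -
    have r: "restrict f ?F \<in> carrier (G_prod G ?F)" using restrict_carrier[OF sub(3)] that by simp
    show ?thesis
      unfolding GF.Irr_column_orthogonality[OF GF.one_closed r] classone by (simp del: one_G_prod carrier_G_prod)
  qed
  have "(\<Sum>f\<in>carrier (G_prod G E1). \<psi>1 f * ?s f) =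
      (\<Sum>f\<in>carrier (G_prod G E1). \<Sum>\<phi>\<in>Irr (G_prod G ?F).
        \<phi> \<one>\<^bsub>G_prod G ?F\<^esub> * (\<psi>1 f * cnj (inflate G E1 ?F \<phi> f)))"
    unfolding sum_distrib_left
    by (intro sum.cong refl) (simp add: inflate_apply mult_ac del: one_G_prod)
  also have "\<dots> = (\<Sum>\<phi>\<in>Irr (G_prod G ?F).
      \<phi> \<one>\<^bsub>G_prod G ?F\<^esub> * (\<Sum>f\<in>carrier (G_prod G E1). \<psi>1 f * cnj (inflate G E1 ?F \<phi> f)))"
    unfolding sum_distrib_left by (rule sum.swap)
  also have "\<dots> = 0"
  proof (rule sum.neutral, rule ballI)
    fix \<phi> assume \<phi>: "\<phi> \<in> Irr (G_prod G ?F)"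
    then have "\<psi>1 \<noteq> inflate G E1 ?F \<phi>" using contra by blast
    then have "(\<Sum>f\<in>carrier (G_prod G E1). \<psi>1 f * cnj (inflate G E1 ?F \<phi> f)) = 0"
      using G1.Irr_orthonormal[OF \<psi> inflate_Irr[OF sub(1,3) \<phi>]] by simp
    then show "\<phi> \<one>\<^bsub>G_prod G ?F\<^esub> * (\<Sum>f\<in>carrier (G_prod G E1). \<psi>1 f * cnj (inflate G E1 ?F \<phi> f)) = 0"
      by simp
  qed
  finally have zero: "(\<Sum>f\<in>carrier (G_prod G E1). \<psi>1 f * ?s f) = 0" .
  let ?K = "{f \<in> carrier (G_prod G E1). restrict f ?F = \<one>\<^bsub>G_prod G ?F\<^esub>}"
  \<comment> \<open>Evaluated on the support \<open>?K\<close>, the same sum is a product of three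
    nonzero numbers: the order of \<open>?K\<close>, the degree of \<psi>1 and
    \<open>?c\<close>.\<close>
  have "(\<Sum>f\<in>carrier (G_prod G E1). \<psi>1 f * ?s f) = (\<Sum>f\<in>?K. \<psi>1 \<one>\<^bsub>G_prod G E1\<^esub> * ?c)"
    unfolding sum.inter_filter[OF G1.finite_carrier]
    by (rule sum.cong[OF refl]) (simp add: s ker del: one_G_prod carrier_G_prod)
  also have "\<dots> = of_nat (card ?K) * (\<psi>1 \<one>\<^bsub>G_prod G E1\<^esub> * ?c)" by simp
  finally have "of_nat (card ?K) * (\<psi>1 \<one>\<^bsub>G_prod G E1\<^esub> * ?c) = 0" using zero by simp
  moreover have "\<one>\<^bsub>G_prod G E1\<^esub> \<in> ?K" using G1.one_closed by (auto simp: fun_eq_iff)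
  then have "card ?K \<noteq> 0" using G1.finite_carrier by (auto simp del: one_G_prod)
  moreover have "\<psi>1 \<one>\<^bsub>G_prod G E1\<^esub> \<noteq> 0" using G1.Irr_one_ge_1[OF \<psi>] by force
  moreover have "?c \<noteq> 0" using GF.card_carrier_pos by simp
  ultimately show False by (simp del: one_G_prod carrier_G_prod)
qed

lemma Prim_subset_Irr: "Prim G D \<subseteq> Irr (G_prod G D)"
  by (auto simp: Prim_def)

text \<open>If the intersection were a proper subset of \<open>E1\<close>, then \<psi>1 would be
  inflated from it and fail to be primitive; likewise for \<open>E2\<close> and \<psi>2.\<close>

lemma Prim_inflate_unique:
  assumes D: "D \<subseteq> \<Lambda>" and E: "E1 \<subseteq> D" "E2 \<subseteq> D" and \<psi>: "\<psi>1 \<in> Prim G E1" "\<psi>2 \<in> Prim G E2"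
    and eq: "inflate G D E1 \<psi>1 = inflate G D E2 \<psi>2"
  shows "E1 = E2"
proof -
  have "\<not> E1 \<inter> E2 \<subset> E1"
    using inflate_eq_imp_inter[OF D E _ eq] \<psi>(1) by (auto simp: Prim_def)
  moreover have "\<not> E2 \<inter> E1 \<subset> E2"
    using inflate_eq_imp_inter[OF D E(2,1) _ eq[symmetric]] \<psi>(2) by (auto simp: Prim_def)
  ultimately show ?thesis by blast
qed

lemma finite_Prim: "D \<subseteq> \<Lambda> \<Longrightarrow> finite (Prim G D)"
  using fin_group.finite_Irr[OF fin_group_G_prod] Prim_subset_Irr finite_subset by metis

text \<open>Inflation maps the disjoint union of the \<open>Prim G E\<close> bijectively onto the
  irreducible characters: \<open>Irr_from_Prim\<close> gives surjectivity,
  \<open>Prim_inflate_unique\<close> disjointness of the images, and \<open>inflate_inj\<close>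
  injectivity on each piece.\<close>

lemma sum_Irr_eq_sum_Prim:
  assumes D: "D \<subseteq> \<Lambda>"
  shows "(\<Sum>\<chi>\<in>Irr (G_prod G D). F \<chi>) = (\<Sum>E\<in>Pow D. \<Sum>\<psi>\<in>Prim G E. F (inflate G D E \<psi>))"
proof -
  have "Irr (G_prod G D) = (\<Union>E\<in>Pow D. inflate G D E ` Prim G E)"
  proof (intro subset_antisym subsetI)
    fix \<chi> assume "\<chi> \<in> Irr (G_prod G D)"
    then show "\<chi> \<in> (\<Union>E\<in>Pow D. inflate G D E ` Prim G E)" using Irr_from_Prim[OF D] by blast
  next
    fix \<chi> assume "\<chi> \<in> (\<Union>E\<in>Pow D. inflate G D E ` Prim G E)"
    then obtain E \<psi> where "E \<subseteq> D" "\<psi> \<in> Prim G E" "\<chi> = inflate G D E \<psi>" by blast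
    then show "\<chi> \<in> Irr (G_prod G D)" using inflate_Irr[OF D] Prim_subset_Irr[of E] by blast
  qed
  then have "(\<Sum>\<chi>\<in>Irr (G_prod G D). F \<chi>) = (\<Sum>\<chi>\<in>(\<Union>E\<in>Pow D. inflate G D E ` Prim G E). F \<chi>)"
    by simp
  also have "\<dots> = (\<Sum>E\<in>Pow D. \<Sum>\<chi>\<in>inflate G D E ` Prim G E. F \<chi>)"
  proof (rule sum.UNION_disjoint)
    show "finite (Pow D)" using finite_sub[OF D] by simp
    show "\<forall>E\<in>Pow D. finite (inflate G D E ` Prim G E)" using finite_Prim D by (meson PowD finite_imageI subset_trans)
    show "\<forall>E1\<in>Pow D. \<forall>E2\<in>Pow D. E1 \<noteq> E2 \<longrightarrow> inflate G D E1 ` Prim G E1 \<inter> inflate G D E2 ` Prim G E2 = {}"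
      using Prim_inflate_unique[OF D] by blast
  qed
  also have "\<dots> = (\<Sum>E\<in>Pow D. \<Sum>\<psi>\<in>Prim G E. F (inflate G D E \<psi>))"
  proof (rule sum.cong[OF refl])
    fix E assume E: "E \<in> Pow D"
    have "inj_on (inflate G D E) (Prim G E)"
      using inflate_inj[OF D, of E] E Prim_subset_Irr by (meson PowD inj_onI subsetD)
    then show "(\<Sum>\<chi>\<in>inflate G D E ` Prim G E. F \<chi>) = (\<Sum>\<psi>\<in>Prim G E. F (inflate G D E \<psi>))"
      by (simp add: sum.reindex)
  qed
  finally show ?thesis .
qed

end

text \<open>Each factor is written as \<open>(f l - 1) + 1\<close> and the product is
  expanded.\<close>

lemma prod_eq_sum_Pow:
  fixes f :: "'i \<Rightarrow> 'c :: comm_ring_1"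
  assumes "finite D"
  shows "(\<Prod>l\<in>D. f l) = (\<Sum>E\<in>Pow D. \<Prod>l\<in>E. f l - 1)"
  using prod_add[OF assms, of "\<lambda>l. f l - 1" "\<lambda>_. 1"] by simp

section \<open>Kernels of characters evaluated along \<rho>\<close>

locale sieve_setup = group_family G \<Lambda> for G :: "'l \<Rightarrow> ('g, 'b) monoid_scheme" and \<Lambda> +
  fixes X :: "'x set" and \<rho> :: "'l \<Rightarrow> 'x \<Rightarrow> 'g set"
  assumes rho_class: "\<And>l v. l \<in> \<Lambda> \<Longrightarrow> v \<in> X \<Longrightarrow> \<rho> l v \<in> conj_classes (G l)"
begin

text \<open>On a common class this is the reciprocal of its \<open>class_measure\<close>, the form
  in which the measure enters the sieve.\<close>

definition kernel :: "'l \<Rightarrow> 'x \<Rightarrow> 'x \<Rightarrow> real" where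
  "kernel l v w = (if \<rho> l v = \<rho> l w then real (card (carrier (G l))) / real (card (\<rho> l v)) else 0)"

lemma rho_D_rep:
  assumes D: "D \<subseteq> \<Lambda>" and v: "v \<in> X"
  obtains x where "x \<in> (\<Pi>\<^sub>E l\<in>D. carrier (G l))" "x \<in> rho_D \<rho> D v"
    "rho_D \<rho> D v = conj_class (G_prod G D) x" "\<And>l. l \<in> D \<Longrightarrow> \<rho> l v = conj_class (G l) (x l)"
proof -
  have "\<forall>l\<in>D. \<exists>x. x \<in> carrier (G l) \<and> \<rho> l v = conj_class (G l) x"
    using rho_class[OF _ v] D by (fastforce simp: conj_classes_def)
  then obtain y where y: "\<And>l. l \<in> D \<Longrightarrow> y l \<in> carrier (G l)" "\<And>l. l \<in> D \<Longrightarrow> \<rho> l v = conj_class (G l) (y l)"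
    by metis
  define x where "x = restrict y D"
  have x: "x \<in> (\<Pi>\<^sub>E l\<in>D. carrier (G l))" using y(1) by (auto simp: x_def)
  have xl: "\<rho> l v = conj_class (G l) (x l)" if "l \<in> D" for l using y(2) that by (simp add: x_def)
  have r: "rho_D \<rho> D v = conj_class (G_prod G D) x"
    unfolding rho_D_def conj_class_G_prod[OF D x] by (rule PiE_cong) (rule xl)
  have "x \<in> conj_class (G_prod G D) x"
    by (rule fin_group.conj_class_self[OF fin_group_G_prod[OF D]]) (use x in simp)
  with that[OF x _ r xl] r show ?thesis by simp
qed

lemma rho_D_class: "D \<subseteq> \<Lambda> \<Longrightarrow> v \<in> X \<Longrightarrow> rho_D \<rho> D v \<in> conj_classes (G_prod G D)"
  by (rule rho_D_rep[of D v]) (auto simp: conj_classes_def)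

text \<open>Restricting a representative of the class over \<open>D\<close> gives a representative
  of the class over \<open>E\<close>.\<close>

lemma eval_inflate:
  assumes D: "D \<subseteq> \<Lambda>" and E: "E \<subseteq> D" and v: "v \<in> X" and \<psi>: "\<psi> \<in> Irr (G_prod G E)"
  shows "eval_class (inflate G D E \<psi>) (rho_D \<rho> D v) = eval_class \<psi> (rho_D \<rho> E v)"
proof -
  have E': "E \<subseteq> \<Lambda>" using D E by simp
  obtain x where x: "x \<in> (\<Pi>\<^sub>E l\<in>D. carrier (G l))" "x \<in> rho_D \<rho> D v" using rho_D_rep[OF D v] by metis
  have "restrict x E \<in> rho_D \<rho> E v" using x(2) E by (auto simp: rho_D_def)
  then have "eval_class \<psi> (rho_D \<rho> E v) = \<psi> (restrict x E)"
    by (rule fin_group.eval_class_eq[OF fin_group_G_prod[OF E'] \<psi> rho_D_class[OF E' v]])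
  moreover have "eval_class (inflate G D E \<psi>) (rho_D \<rho> D v) = inflate G D E \<psi> x"
    by (rule fin_group.eval_class_eq[OF fin_group_G_prod[OF D] inflate_Irr[OF D E \<psi>] rho_D_class[OF D v] x(2)])
  ultimately show ?thesis by (simp add: inflate_apply[OF x(1)])
qed

lemma Irr_kernel:
  assumes D: "D \<subseteq> \<Lambda>" and v: "v \<in> X" and w: "w \<in> X"
  shows "(\<Sum>\<chi>\<in>Irr (G_prod G D). eval_class \<chi> (rho_D \<rho> D v) * cnj (eval_class \<chi> (rho_D \<rho> D w))) =
    of_real (\<Prod>l\<in>D. kernel l v w)"
proof -
  interpret GD: fin_group "G_prod G D" by (rule fin_group_G_prod[OF D])
  obtain x where x: "x \<in> (\<Pi>\<^sub>E l\<in>D. carrier (G l))" "x \<in> rho_D \<rho> D v"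
    "rho_D \<rho> D v = conj_class (G_prod G D) x" using rho_D_rep[OF D v] by metis
  obtain y where y: "y \<in> (\<Pi>\<^sub>E l\<in>D. carrier (G l))" "y \<in> rho_D \<rho> D w" using rho_D_rep[OF D w] by metis
  have fin: "finite D" by (rule finite_sub[OF D])
  have "(\<Sum>\<chi>\<in>Irr (G_prod G D). eval_class \<chi> (rho_D \<rho> D v) * cnj (eval_class \<chi> (rho_D \<rho> D w))) =
      (\<Sum>\<chi>\<in>Irr (G_prod G D). \<chi> x * cnj (\<chi> y))"
    by (intro sum.cong refl) (simp add: GD.eval_class_eq[OF _ rho_D_class[OF D v] x(2)] GD.eval_class_eq[OF _ rho_D_class[OF D w] y(2)])
  also have "\<dots> = (if y \<in> rho_D \<rho> D v then of_nat (card (carrier (G_prod G D))) / of_nat (card (rho_D \<rho> D v)) else 0)"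
    unfolding x(3) by (rule GD.Irr_column_orthogonality) (use x y in auto)
  also have "\<dots> = of_real (\<Prod>l\<in>D. kernel l v w)"
  proof (cases "\<forall>l\<in>D. \<rho> l v = \<rho> l w")
    case True
    then have "rho_D \<rho> D v = rho_D \<rho> D w" unfolding rho_D_def by (intro PiE_cong) auto
    moreover have "card (carrier (G_prod G D)) = (\<Prod>l\<in>D. card (carrier (G l)))"
      "card (rho_D \<rho> D v) = (\<Prod>l\<in>D. card (\<rho> l v))"
      using fin by (simp_all add: rho_D_def card_PiE)
    moreover have "(\<Prod>l\<in>D. kernel l v w) = (\<Prod>l\<in>D. real (card (carrier (G l))) / real (card (\<rho> l v)))"
      using True by (intro prod.cong) (auto simp: kernel_def)
    ultimately show ?thesis using y(2) by (simp add: prod_dividef)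
  next
    case False
    then obtain l where l: "l \<in> D" "\<rho> l v \<noteq> \<rho> l w" by blast
    have lL: "l \<in> \<Lambda>" using l D by blast
    have "y \<notin> rho_D \<rho> D v"
    proof
      assume "y \<in> rho_D \<rho> D v"
      then have "y l \<in> \<rho> l v" "y l \<in> \<rho> l w" using y(2) l(1) by (auto simp: rho_D_def)
      then show False
        using fin_group.conj_class_eq[OF fin_group[OF lL] rho_class[OF lL]] v w l(2) by metis
    qed
    moreover have "(\<Prod>l\<in>D. kernel l v w) = 0"
      using fin l by (auto simp: kernel_def intro!: bexI[of _ l])
    ultimately show ?thesis by simp
  qed
  finally show ?thesis .
qed

text \<open>Strong induction takes the place of Moebius inversion. Summed over all subsets of
  \<open>D\<close>, both sides give the product of the kernels, and the terms of proper subsets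
  agree by the induction hypothesis.\<close>

theorem Prim_kernel:
  assumes "D \<subseteq> \<Lambda>" and v: "v \<in> X" and w: "w \<in> X"
  shows "(\<Sum>\<chi>\<in>Prim G D. eval_class \<chi> (rho_D \<rho> D v) * cnj (eval_class \<chi> (rho_D \<rho> D w))) =
    of_real (\<Prod>l\<in>D. kernel l v w - 1)"
  using finite_sub[OF assms(1)] assms(1)
proof (induction D rule: finite_psubset_induct)
  case (psubset D)
  note D = \<open>D \<subseteq> \<Lambda>\<close>
  define P where "P E = (\<Sum>\<chi>\<in>Prim G E. eval_class \<chi> (rho_D \<rho> E v) * cnj (eval_class \<chi> (rho_D \<rho> E w)))" for E
  have split: "(\<Sum>E\<in>Pow D. F E) = F D + (\<Sum>E\<in>Pow D - {D}. F E)" for F :: "'l set \<Rightarrow> complex"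
    using psubset.hyps by (intro sum.remove) auto
  have "(\<Sum>E\<in>Pow D. P E) = (\<Sum>E\<in>Pow D. \<Sum>\<psi>\<in>Prim G E. eval_class (inflate G D E \<psi>) (rho_D \<rho> D v) *
      cnj (eval_class (inflate G D E \<psi>) (rho_D \<rho> D w)))"
    unfolding P_def using Prim_subset_Irr
    by (intro sum.cong refl) (simp add: eval_inflate[OF D] v w subset_iff)
  also have "\<dots> = of_real (\<Prod>l\<in>D. kernel l v w)"
    using sum_Irr_eq_sum_Prim[OF D, where F = "\<lambda>\<chi>. eval_class \<chi> (rho_D \<rho> D v) * cnj (eval_class \<chi> (rho_D \<rho> D w))"]
      Irr_kernel[OF D v w] by simp
  also have "\<dots> = (\<Sum>E\<in>Pow D. of_real (\<Prod>l\<in>E. kernel l v w - 1))"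
    by (subst prod_eq_sum_Pow[OF psubset.hyps]) simp
  finally have "P D + (\<Sum>E\<in>Pow D - {D}. P E) = of_real (\<Prod>l\<in>D. kernel l v w - 1) +
      (\<Sum>E\<in>Pow D - {D}. of_real (\<Prod>l\<in>E. kernel l v w - 1))"
    by (simp only: split)
  moreover have "(\<Sum>E\<in>Pow D - {D}. P E) = (\<Sum>E\<in>Pow D - {D}. of_real (\<Prod>l\<in>E. kernel l v w - 1))"
    unfolding P_def using D by (intro sum.cong refl psubset.IH) auto
  ultimately show ?case by (simp add: P_def)
qed

end

section \<open>Positive semidefinite kernels\<close>

text \<open>Positive semidefiniteness is encoded as a Gram factorization, so that closure under Schur
  products is immediate.\<close>

definition gram_on :: "'x set \<Rightarrow> ('x \<Rightarrow> 'x \<Rightarrow> real) \<Rightarrow> bool" where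
  "gram_on S k \<longleftrightarrow> (\<exists>(I :: nat set) f. finite I \<and> (\<forall>v\<in>S. \<forall>w\<in>S. k v w = (\<Sum>i\<in>I. f i v * f i w)))"

text \<open>Index sets of any type are transported to the naturals, which \<open>gram_on\<close>
  fixes so as not to quantify over types.\<close>

lemma gram_onI:
  fixes I :: "'i set"
  assumes I: "finite I" and k: "\<And>v w. v \<in> S \<Longrightarrow> w \<in> S \<Longrightarrow> k v w = (\<Sum>i\<in>I. f i v * f i w)"
  shows "gram_on S k"
proof -
  obtain h where h: "bij_betw h {0..<card I} I" using ex_bij_betw_nat_finite[OF I] by blast
  have "k v w = (\<Sum>j\<in>{0..<card I}. f (h j) v * f (h j) w)" if "v \<in> S" "w \<in> S" for v w
    using sum.reindex_bij_betw[OF h, of "\<lambda>i. f i v * f i w"] k that by simp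
  then show ?thesis unfolding gram_on_def by (intro exI[of _ "{0..<card I}"] exI[of _ "\<lambda>j. f (h j)"]) auto
qed

text \<open>The products \<open>f i v * g j v\<close>, indexed by pairs, factor the product
  kernel.\<close>

lemma gram_on_mult:
  assumes "gram_on S k" "gram_on S k'"
  shows "gram_on S (\<lambda>v w. k v w * k' v w)"
proof -
  obtain I :: "nat set" and f where I: "finite I" "\<And>v w. v \<in> S \<Longrightarrow> w \<in> S \<Longrightarrow> k v w = (\<Sum>i\<in>I. f i v * f i w)"
    using assms(1) by (auto simp: gram_on_def)
  obtain J :: "nat set" and g where J: "finite J" "\<And>v w. v \<in> S \<Longrightarrow> w \<in> S \<Longrightarrow> k' v w = (\<Sum>j\<in>J. g j v * g j w)"
    using assms(2) by (auto simp: gram_on_def)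
  show ?thesis
  proof (rule gram_onI[of "I \<times> J" _ _ "\<lambda>(i, j) v. f i v * g j v"])
    show "k v w * k' v w = (\<Sum>p\<in>I \<times> J. (case p of (i, j) \<Rightarrow> \<lambda>v. f i v * g j v) v * (case p of (i, j) \<Rightarrow> \<lambda>v. f i v * g j v) w)"
      if "v \<in> S" "w \<in> S" for v w
      unfolding I(2)[OF that] J(2)[OF that] sum_product sum.cartesian_product
      by (intro sum.cong refl) (auto simp: mult_ac)
  qed (use I J in auto)
qed

lemma gram_on_add:
  assumes "gram_on S k" "gram_on S k'"
  shows "gram_on S (\<lambda>v w. k v w + k' v w)"
proof -
  obtain I :: "nat set" and f where I: "finite I" "\<And>v w. v \<in> S \<Longrightarrow> w \<in> S \<Longrightarrow> k v w = (\<Sum>i\<in>I. f i v * f i w)"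
    using assms(1) by (auto simp: gram_on_def)
  obtain J :: "nat set" and g where J: "finite J" "\<And>v w. v \<in> S \<Longrightarrow> w \<in> S \<Longrightarrow> k' v w = (\<Sum>j\<in>J. g j v * g j w)"
    using assms(2) by (auto simp: gram_on_def)
  show ?thesis
  proof (rule gram_onI[of "I <+> J" _ _ "case_sum f g"])
    show "k v w + k' v w = (\<Sum>p\<in>I <+> J. case_sum f g p v * case_sum f g p w)" if "v \<in> S" "w \<in> S" for v w
      using I(1) J(1) by (simp add: I(2)[OF that] J(2)[OF that] sum.Plus)
  qed (use I J in auto)
qed

lemma gram_on_const: "0 \<le> c \<Longrightarrow> gram_on S (\<lambda>v w. c)"
  by (rule gram_onI[of "{()}" _ _ "\<lambda>_ _. sqrt c"]) auto

lemma gram_on_cong: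
  "gram_on S k \<Longrightarrow> (\<And>v w. v \<in> S \<Longrightarrow> w \<in> S \<Longrightarrow> k v w = k' v w) \<Longrightarrow> gram_on S k'"
  unfolding gram_on_def by simp

text \<open>The total is a sum of squares, one for the sum of each \<open>f i\<close> over
  \<open>S\<close>. Pairing with the all-ones vector suffices, because the test sequence is an
  indicator.\<close>

lemma gram_on_sum_nonneg:
  assumes "gram_on S k"
  shows "0 \<le> (\<Sum>v\<in>S. \<Sum>w\<in>S. k v w)"
proof -
  obtain I :: "nat set" and f where I: "finite I" "\<And>v w. v \<in> S \<Longrightarrow> w \<in> S \<Longrightarrow> k v w = (\<Sum>i\<in>I. f i v * f i w)"
    using assms by (auto simp: gram_on_def)
  have "(\<Sum>v\<in>S. \<Sum>w\<in>S. k v w) = (\<Sum>v\<in>S. \<Sum>w\<in>S. \<Sum>i\<in>I. f i v * f i w)"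
    by (intro sum.cong refl) (simp add: I(2))
  also have "\<dots> = (\<Sum>v\<in>S. \<Sum>i\<in>I. \<Sum>w\<in>S. f i v * f i w)"
    by (intro sum.cong refl) (rule sum.swap)
  also have "\<dots> = (\<Sum>i\<in>I. \<Sum>v\<in>S. \<Sum>w\<in>S. f i v * f i w)" by (rule sum.swap)
  also have "\<dots> = (\<Sum>i\<in>I. (\<Sum>v\<in>S. f i v)\<^sup>2)" by (simp add: sum_product power2_eq_square)
  finally show ?thesis by (simp add: sum_nonneg)
qed

text \<open>Adding a factor m splits the difference as (prod k - prod c) k_m + (prod c)(k_m - c_m).
  Nonnegativity of the constants makes k_m and both summands positive semidefinite.\<close>

lemma gram_on_prod_diff:
  assumes "finite D"
    and "\<And>l. l \<in> D \<Longrightarrow> gram_on S (\<lambda>v w. k l v w - c l)" and "\<And>l. l \<in> D \<Longrightarrow> 0 \<le> c l"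
  shows "gram_on S (\<lambda>v w. (\<Prod>l\<in>D. k l v w) - (\<Prod>l\<in>D. c l))"
  using assms
proof (induction D rule: finite_induct)
  case empty
  show ?case using gram_on_const[of 0 S] by simp
next
  case (insert m D)
  have m: "gram_on S (\<lambda>v w. k m v w - c m)" "0 \<le> c m" using insert.prems by auto
  have km: "gram_on S (k m)" by (rule gram_on_cong[OF gram_on_add[OF m(1) gram_on_const[OF m(2)]]]) simp
  have IH: "gram_on S (\<lambda>v w. (\<Prod>l\<in>D. k l v w) - (\<Prod>l\<in>D. c l))" using insert by auto
  have nn: "0 \<le> (\<Prod>l\<in>D. c l)" using insert.prems by (intro prod_nonneg) auto
  from gram_on_add[OF gram_on_mult[OF IH km] gram_on_mult[OF gram_on_const[OF nn] m(1)]]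
  show ?case by (rule gram_on_cong) (use insert.hyps in \<open>simp add: algebra_simps\<close>)
qed

section \<open>The lower bound for primitive characters\<close>

context sieve_setup
begin

lemma class_finite_pos:
  assumes "l \<in> \<Lambda>" "v \<in> X"
  shows "finite (\<rho> l v)" "card (\<rho> l v) > 0"
proof -
  interpret fin_group "G l" by (rule fin_group[OF assms(1)])
  obtain x where x: "x \<in> carrier (G l)" "\<rho> l v = conj_class (G l) x"
    using rho_class[OF assms] by (auto simp: conj_classes_def)
  show fin: "finite (\<rho> l v)" unfolding x(2) using conj_class_subset[OF x(1)] finite_carrier by (rule finite_subset)
  show "card (\<rho> l v) > 0" using fin conj_class_self[OF x(1)] x(2) by (auto simp: card_gt_0_iff)
qed

text \<open>Cauchy-Schwarz in factored form, for the exact measure \<open>m\<close> of the occupied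
  classes, which is positive as \<open>S\<close> is nonempty. Passing from 1/m to 1/\<delta> adds
  the nonnegative constant 1/m - 1/\<delta>.\<close>

lemma gram_on_kernel:
  assumes l: "l \<in> \<Lambda>" and S: "finite S" "S \<subseteq> X" "S \<noteq> {}"
    and \<delta>: "0 < \<delta>" "class_measure (G l) (\<rho> l ` S) \<le> \<delta>"
  shows "gram_on S (\<lambda>v w. kernel l v w - 1 / \<delta>)"
proof -
  let ?T = "\<rho> l ` S"
  define \<mu> where "\<mu> C = real (card C) / real (card (carrier (G l)))" for C :: "'g set"
  define m where "m = (\<Sum>C\<in>?T. \<mu> C)"
  have N: "card (carrier (G l)) > 0" by (rule fin_group.card_carrier_pos[OF fin_group[OF l]])
  have \<mu>_pos: "\<mu> C > 0" if "C \<in> ?T" for C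
    using that class_finite_pos(2)[OF l] S(2) N by (auto simp: \<mu>_def)
  have m_pos: "m > 0" unfolding m_def using S \<mu>_pos by (intro sum_pos) auto
  have m_le: "m \<le> \<delta>" using \<delta>(2) by (simp add: m_def \<mu>_def class_measure_def sum_divide_distrib)
  have kernel: "kernel l v w = (if \<rho> l v = \<rho> l w then 1 / \<mu> (\<rho> l v) else 0)" for v w
    by (simp add: kernel_def \<mu>_def)
  have "gram_on S (\<lambda>v w. kernel l v w - 1 / m)"
  \<comment> \<open>Each point \<open>v\<close> is sent to the density of its class in L^2 of the
    occupied classes, minus its mean 1/m, with the square root absorbing the measure. The cross
    terms give -1/m twice and the constant term gives m/m^2 back.\<close>
  proof (rule gram_onI[of ?T _ _ "\<lambda>C v. ((if \<rho> l v = C then 1 / \<mu> C else 0) - 1 / m) * sqrt (\<mu> C)"])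
    fix v w assume v: "v \<in> S" and w: "w \<in> S"
    let ?a = "\<lambda>v C. if \<rho> l v = C then 1 / \<mu> C else 0"
    have "(\<Sum>C\<in>?T. (?a v C - 1 / m) * sqrt (\<mu> C) * ((?a w C - 1 / m) * sqrt (\<mu> C))) =
        (\<Sum>C\<in>?T. (if C = \<rho> l v then (if \<rho> l v = \<rho> l w then 1 / \<mu> C else 0) else 0)
          - (if C = \<rho> l v then 1 / m else 0) - (if C = \<rho> l w then 1 / m else 0) + \<mu> C / m\<^sup>2)"
    proof (rule sum.cong[OF refl])
      fix C assume C: "C \<in> ?T"
      have "(?a v C - 1 / m) * sqrt (\<mu> C) * ((?a w C - 1 / m) * sqrt (\<mu> C)) = (?a v C - 1 / m) * (?a w C - 1 / m) * (sqrt (\<mu> C) * sqrt (\<mu> C))"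
        by (simp only: mult_ac)
      also have "sqrt (\<mu> C) * sqrt (\<mu> C) = \<mu> C" using \<mu>_pos[OF C] by simp
      also have "(?a v C - 1 / m) * (?a w C - 1 / m) * \<mu> C = (if C = \<rho> l v then (if \<rho> l v = \<rho> l w then 1 / \<mu> C else 0) else 0)
          - (if C = \<rho> l v then 1 / m else 0) - (if C = \<rho> l w then 1 / m else 0) + \<mu> C / m\<^sup>2"
        using \<mu>_pos[OF C] m_pos by (auto simp: field_simps power2_eq_square)
      finally show "(?a v C - 1 / m) * sqrt (\<mu> C) * ((?a w C - 1 / m) * sqrt (\<mu> C)) =
          (if C = \<rho> l v then (if \<rho> l v = \<rho> l w then 1 / \<mu> C else 0) else 0)
          - (if C = \<rho> l v then 1 / m else 0) - (if C = \<rho> l w then 1 / m else 0) + \<mu> C / m\<^sup>2" .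
    qed
    also have "\<dots> = kernel l v w - 1 / m - 1 / m + m / m\<^sup>2"
      using S(1) v w by (simp add: sum.distrib sum_subtractf sum_divide_distrib[symmetric] m_def[symmetric] kernel)
    also have "\<dots> = kernel l v w - 1 / m" using m_pos by (simp add: power2_eq_square)
    finally show "kernel l v w - 1 / m = (\<Sum>C\<in>?T. (?a v C - 1 / m) * sqrt (\<mu> C) * ((?a w C - 1 / m) * sqrt (\<mu> C)))" ..
  qed (use S in auto)
  moreover have "0 \<le> 1 / m - 1 / \<delta>" using m_pos m_le \<delta>(1) by (simp add: frac_le)
  ultimately have "gram_on S (\<lambda>v w. kernel l v w - 1 / m + (1 / m - 1 / \<delta>))"
    by (intro gram_on_add gram_on_const)
  then show ?thesis by simp
qed

lemma Prim_sum_lower_bound: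
  assumes D: "D \<subseteq> \<Lambda>" and S: "finite S" "S \<subseteq> X"
    and \<delta>: "\<And>l. l \<in> \<Lambda> \<Longrightarrow> 0 < \<delta> l" "\<And>l. l \<in> \<Lambda> \<Longrightarrow> \<delta> l \<le> 1"
      "\<And>l. l \<in> \<Lambda> \<Longrightarrow> class_measure (G l) (\<rho> l ` S) \<le> \<delta> l"
  shows "(\<Prod>l\<in>D. (1 - \<delta> l) / \<delta> l) * (real (card S))\<^sup>2 \<le>
    (\<Sum>\<chi>\<in>Prim G D. (cmod (\<Sum>v\<in>S. eval_class \<chi> (rho_D \<rho> D v)))\<^sup>2)"
\<comment> \<open>The empty set is set apart because \<open>gram_on_kernel\<close> divides by the
  measure of the occupied classes; the left side is then 0.\<close>
proof (cases "S = {}")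
  case False
  let ?e = "\<lambda>\<chi> v. eval_class \<chi> (rho_D \<rho> D v)"
  have "complex_of_real (\<Sum>\<chi>\<in>Prim G D. (cmod (\<Sum>v\<in>S. ?e \<chi> v))\<^sup>2) =
      (\<Sum>\<chi>\<in>Prim G D. \<Sum>v\<in>S. \<Sum>w\<in>S. ?e \<chi> v * cnj (?e \<chi> w))"
    by (simp only: of_real_sum complex_norm_square cnj_sum sum_product)
  also have "\<dots> = (\<Sum>v\<in>S. \<Sum>\<chi>\<in>Prim G D. \<Sum>w\<in>S. ?e \<chi> v * cnj (?e \<chi> w))" by (rule sum.swap)
  also have "\<dots> = (\<Sum>v\<in>S. \<Sum>w\<in>S. \<Sum>\<chi>\<in>Prim G D. ?e \<chi> v * cnj (?e \<chi> w))"
    by (intro sum.cong refl) (rule sum.swap)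
  also have "\<dots> = (\<Sum>v\<in>S. \<Sum>w\<in>S. of_real (\<Prod>l\<in>D. kernel l v w - 1))"
    using S(2) by (intro sum.cong refl Prim_kernel[OF D]) auto
  also have "\<dots> = of_real (\<Sum>v\<in>S. \<Sum>w\<in>S. \<Prod>l\<in>D. kernel l v w - 1)" by simp
  finally have eq: "(\<Sum>\<chi>\<in>Prim G D. (cmod (\<Sum>v\<in>S. ?e \<chi> v))\<^sup>2) = (\<Sum>v\<in>S. \<Sum>w\<in>S. \<Prod>l\<in>D. kernel l v w - 1)"
    by (simp only: of_real_eq_iff)
  \<comment> \<open>Taking the sieve constant from \<open>kernel l v w - 1\<close> thus leaves the
    kernel minus 1/\<delta>, the form treated by \<open>gram_on_kernel\<close>.\<close>
  have c: "(1 - \<delta> l) / \<delta> l = 1 / \<delta> l - 1" if "l \<in> D" for l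
    using \<delta>(1)[of l] that D by (auto simp: field_simps)
  have "gram_on S (\<lambda>v w. (\<Prod>l\<in>D. kernel l v w - 1) - (\<Prod>l\<in>D. (1 - \<delta> l) / \<delta> l))"
  proof (rule gram_on_prod_diff[OF finite_sub[OF D]])
    fix l assume "l \<in> D"
    then have l: "l \<in> \<Lambda>" using D by blast
    show "gram_on S (\<lambda>v w. kernel l v w - 1 - (1 - \<delta> l) / \<delta> l)"
      unfolding c[OF \<open>l \<in> D\<close>] using gram_on_kernel[OF l S False \<delta>(1)[OF l] \<delta>(3)[OF l]] by simp
    show "0 \<le> (1 - \<delta> l) / \<delta> l" using \<delta>(1,2)[OF l] by simp
  qed
  from gram_on_sum_nonneg[OF this]
  have "0 \<le> (\<Sum>v\<in>S. \<Sum>w\<in>S. \<Prod>l\<in>D. kernel l v w - 1) - (\<Prod>l\<in>D. (1 - \<delta> l) / \<delta> l) * (real (card S))\<^sup>2"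
    by (simp add: sum_subtractf power2_eq_square mult_ac)
  then show ?thesis unfolding eq by simp
qed simp

end

section \<open>The large sieve constant\<close>

text \<open>A crude relative of Cauchy-Schwarz that bounds each coefficient by the norm of the whole
  sequence; it serves to exhibit one admissible sieve constant.\<close>

lemma norm_sum_mult_squared_le:
  fixes a b :: "'x \<Rightarrow> complex"
  assumes X: "finite X"
  shows "(cmod (\<Sum>v\<in>X. a v * b v))\<^sup>2 \<le> (\<Sum>v\<in>X. cmod (b v))\<^sup>2 * (\<Sum>v\<in>X. (cmod (a v))\<^sup>2)"
proof -
  let ?A = "\<Sum>v\<in>X. (cmod (a v))\<^sup>2"
  have a: "cmod (a v) \<le> sqrt ?A" if "v \<in> X" for v
    using X that by (intro real_le_rsqrt member_le_sum) auto
  have "cmod (\<Sum>v\<in>X. a v * b v) \<le> (\<Sum>v\<in>X. sqrt ?A * cmod (b v))"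
    using a by (intro sum_norm_le) (simp add: norm_mult mult_right_mono)
  also have "\<dots> = sqrt ?A * (\<Sum>v\<in>X. cmod (b v))" by (simp add: sum_distrib_left)
  finally have "(cmod (\<Sum>v\<in>X. a v * b v))\<^sup>2 \<le> (sqrt ?A * (\<Sum>v\<in>X. cmod (b v)))\<^sup>2"
    by (rule power_mono) simp
  also have "\<dots> = ?A * (\<Sum>v\<in>X. cmod (b v))\<^sup>2"
    by (simp add: power_mult_distrib sum_nonneg)
  finally show ?thesis by (simp add: mult.commute)
qed

theorem theorem2p1:
  fixes G :: "'l \<Rightarrow> ('g, 'b) monoid_scheme"
    and \<Lambda> :: "'l set" and X :: "'x set"
    and \<rho> :: "'l \<Rightarrow> 'x \<Rightarrow> 'g set"
    and Z :: "'l set set" and S :: "'x set" and \<delta> :: "'l \<Rightarrow> real"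
  assumes "finite X" and "finite \<Lambda>"
    and "\<forall>l\<in>\<Lambda>. group (G l) \<and> finite (carrier (G l))"
    and "\<forall>l\<in>\<Lambda>. \<forall>v\<in>X. \<rho> l v \<in> conj_classes (G l)"
    and "Z \<subseteq> Pow \<Lambda>"
    and "S \<subseteq> X"
    and "\<forall>l\<in>\<Lambda>. 0 < \<delta> l \<and> \<delta> l \<le> 1"
    and "\<forall>l\<in>\<Lambda>. class_measure (G l) ((\<lambda>v. \<rho> l v) ` S) \<le> \<delta> l"
  shows "(\<Sum>D\<in>Z. \<Prod>l\<in>D. (1 - \<delta> l) / \<delta> l) * real (card S) \<le> large_sieve_const G X \<rho> Z"
proof -
  have "fin_group (G l)" if "l \<in> \<Lambda>" for l
    using that assms(3) by (simp add: fin_group_def fin_group_axioms_def)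
  then interpret sieve_setup G \<Lambda> X \<rho>
    using assms(2,4) by (simp add: sieve_setup_def sieve_setup_axioms_def group_family_def)
  have finS: "finite S" using assms(1,6) finite_subset by blast
  let ?lhs = "\<lambda>a :: 'x \<Rightarrow> complex. \<Sum>D\<in>Z. \<Sum>\<chi>\<in>Prim G D. (cmod (\<Sum>v\<in>X. a v * eval_class \<chi> (rho_D \<rho> D v)))\<^sup>2"
  \<comment> \<open>An explicit admissible constant, so that the infimum is taken over a nonempty
    set.\<close>
  define c0 where "c0 = (\<Sum>D\<in>Z. \<Sum>\<chi>\<in>Prim G D. (\<Sum>v\<in>X. cmod (eval_class \<chi> (rho_D \<rho> D v)))\<^sup>2)"
  have c0: "0 \<le> c0" unfolding c0_def by (intro sum_nonneg) auto
  have c0_bound: "?lhs a \<le> c0 * (\<Sum>v\<in>X. (cmod (a v))\<^sup>2)" for a :: "'x \<Rightarrow> complex"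
    unfolding c0_def sum_distrib_right by (intro sum_mono norm_sum_mult_squared_le assms(1))
  show ?thesis
    unfolding large_sieve_const_def
  proof (rule cInf_greatest)
    show "{c. 0 \<le> c \<and> (\<forall>a. ?lhs a \<le> c * (\<Sum>v\<in>X. (cmod (a v))\<^sup>2))} \<noteq> {}"
      using c0 c0_bound by blast
    fix c assume "c \<in> {c. 0 \<le> c \<and> (\<forall>a. ?lhs a \<le> c * (\<Sum>v\<in>X. (cmod (a v))\<^sup>2))}"
    moreover define a :: "'x \<Rightarrow> complex" where "a v = (if v \<in> S then 1 else 0)" for v
    ultimately have c: "0 \<le> c" "?lhs a \<le> c * (\<Sum>v\<in>X. (cmod (a v))\<^sup>2)" by auto
    have ind: "(\<Sum>v\<in>X. a v * F v) = (\<Sum>v\<in>S. F v)" for F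
      using assms(1,6) by (intro sum.mono_neutral_cong_right) (auto simp: a_def)
    have "(\<Sum>v\<in>X. (cmod (a v))\<^sup>2) = (\<Sum>v\<in>X. if v \<in> S then 1 else 0)"
      by (intro sum.cong) (auto simp: a_def)
    also have "\<dots> = real (card S)" using assms(1,6) by (simp add: sum.inter_restrict[symmetric] Int_absorb1)
    finally have norm: "(\<Sum>v\<in>X. (cmod (a v))\<^sup>2) = real (card S)" .
    have "(\<Sum>D\<in>Z. \<Prod>l\<in>D. (1 - \<delta> l) / \<delta> l) * (real (card S))\<^sup>2 =
        (\<Sum>D\<in>Z. (\<Prod>l\<in>D. (1 - \<delta> l) / \<delta> l) * (real (card S))\<^sup>2)" by (rule sum_distrib_right)
    also have "\<dots> \<le> ?lhs a"
      unfolding ind using assms by (intro sum_mono Prim_sum_lower_bound finS) auto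
    also have "\<dots> \<le> c * real (card S)" using c(2) by (simp only: norm)
    finally have le: "(\<Sum>D\<in>Z. \<Prod>l\<in>D. (1 - \<delta> l) / \<delta> l) * real (card S) * real (card S) \<le> c * real (card S)"
      by (simp add: power2_eq_square mult_ac)
    \<comment> \<open>A factor \<open>card S\<close> is cancelled; for empty \<open>S\<close> the
      left side is 0, and \<open>0 \<le> c\<close> is part of admissibility.\<close>
    show "(\<Sum>D\<in>Z. \<Prod>l\<in>D. (1 - \<delta> l) / \<delta> l) * real (card S) \<le> c"
    proof (cases "card S = 0")
      case False
      then show ?thesis using le by simp
    qed (use c in simp)
  qed
qed

end
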